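(* Let $\alpha\in(0,1)\setminus\mathbb{Q}$, and let $(\tilde{\mathsf{X}}_\alpha,\tilde{\sigma}_\alpha)$ be the cover of the one-sided Sturmian subshift $(\mathsf{X}_\alpha,\sigma_\alpha)$, with canonical factor map $\pi_\alpha\colon\tilde{\mathsf{X}}_\alpha\to\mathsf{X}_\alpha$ and canonical section $\iota_\alpha\colon\mathsf{X}_\alpha\to\tilde{\mathsf{X}}_\alpha$. Let $\tilde{\Lambda}_\alpha:=\tilde{\mathsf{X}}_\alpha\setminus\iota_\alpha(\mathrm{orb}_\alpha(\omega_\alpha))$ be the collection of nonisolated elements in the cover. The restricted dynamical system $(\tilde{\Lambda}_\alpha,\tilde{\sigma}_\alpha)$ is conjugate to the two-sided Sturmian system $(\Lambda_\alpha,\sigma_\alpha)$. Consequently, there is an injective sliding block code (i.e. an injective continuous map intertwining the shift operations) $i\colon\Lambda_\alpha\to\tilde{\mathsf{X}}_\alpha$ such that $\rho_\alpha=\pi_\alpha\circ i$, where $\rho_\alpha\colon\Lambda_\alpha\to\mathsf{X}_\alpha$ is the canonical truncation.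
   Context: Here $\mathbb{N}=\{0,1,2,\dots\}$ and $\mathbb{T}=\mathbb{R}/\mathbb{Z}$. Two dynamical systems $(Y,S)$ and $(Y',S')$ are conjugate if there is a homeomorphism $h\colon Y\to Y'$ with $h\circ S=S'\circ h$. Sturmian subshifts. For irrational $\alpha\in(0,1)$ let $R_\alpha(t)=t+\alpha\pmod 1$ on $\mathbb{T}$, and let $I_\alpha(t)=0$ for $t\in[0,1-\alpha)$, $I_\alpha(t)=1$ for $t\in[1-\alpha,1)$. The one-sided Sturmian subshift is $\mathsf{X}_\alpha=\overline{\{(I_\alpha(R_\alpha^i(t)))_{i\in\mathbb{N}}:t\in\mathbb{T}\}}\subseteq\{0,1\}^{\mathbb{N}}$ and the two-sided Sturmian subshift is $\Lambda_\alpha=\overline{\{(I_\alpha(R_\alpha^i(t)))_{i\in\mathbb{Z}}:t\in\mathbb{T}\}}\subseteq\{0,1\}^{\mathbb{Z}}$, both with shift $\sigma_\alpha(x)_i=x_{i+1}$ (surjective on $\mathsf{X}_\alpha$, a homeomorphism on $\Lambda_\alpha$). The canonical truncation is $\rho_\alpha(x)=x_{[0,\infty)}$. The orbit of $x\in\mathsf{X}_\alpha$ is $\mathrm{orb}_\alpha(x)=\bigcup_{k,l\in\mathbb{N}}\sigma_\alpha^{-l}(\sigma_\alpha^k(x))$. The branch point $\omega_\alpha\in\mathsf{X}_\alpha$ is the unique point with more than one preimage under $\sigma_\alpha$; it satisfies $\sigma_\alpha^{-1}(\omega_\alpha)=\{0\omega_\alpha,1\omega_\alpha\}$. Cover. Let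 $\mathsf{X}\subseteq\{1,\dots,N\}^{\mathbb{N}}$ (or over any finite alphabet) be closed with $\sigma_{\mathsf{X}}(\mathsf{X})=\mathsf{X}$, where $\sigma_{\mathsf{X}}(x)_i=x_{i+1}$. For $l\in\mathbb{N}$ and $x\in\mathsf{X}$, let $P_l(x)$ be the set of words $\mu$ of length $l$ with $\mu x\in\mathsf{X}$. Let $\mathcal{I}=\{(k,l)\in\mathbb{N}\times\mathbb{N}:k\leq l\}$, partially ordered by $(k_1,l_1)\preceq(k_2,l_2)$ iff $k_1\leq k_2$ and $l_1-k_1\leq l_2-k_2$. For $(k,l)\in\mathcal{I}$ write $x\sim_{k,l}x'$ iff $x_{[0,k)}=x'_{[0,k)}$ and $P_l(\sigma_{\mathsf{X}}^k(x))=P_l(\sigma_{\mathsf{X}}^k(x'))$; let ${}_k[x]_l$ be the class of $x$ and ${}_k\mathsf{X}_l$ the finite (discrete) set of classes. If $(k_1,l_1)\preceq(k_2,l_2)$ there is a well-defined surjection ${}_{k_2}\mathsf{X}_{l_2}\to{}_{k_1}\mathsf{X}_{l_1}$, ${}_{k_2}[x]_{l_2}\mapsto{}_{k_1}[x]_{l_1}$. The cover $\tilde{\mathsf{X}}$ is the projective limit of this system (with the inverse limit topology). For $\tilde{x}\in\tilde{\mathsf{X}}$, let ${}_k\tilde{x}_l\in\mathsf{X}$ denote any representative of its $(k,l)$-coordinate. The shift $\sigma_{\tilde{\mathsf{X}}}$ on $\tilde{\mathsf{X}}$ (a surjective local homeomorphism) sends $\tilde{x}$ to the element with $(k,l)$-coordinate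 ${}_k[\sigma_{\mathsf{X}}({}_{k+1}\tilde{x}_{l+1})]_l$. The map $\pi_{\mathsf{X}}\colon\tilde{\mathsf{X}}\to\mathsf{X}$ sends $\tilde{x}$ to the unique $x$ with $x_{[0,k)}=({}_k\tilde{x}_l)_{[0,k)}$ for all $(k,l)\in\mathcal{I}$, and $\iota_{\mathsf{X}}\colon\mathsf{X}\to\tilde{\mathsf{X}}$ sends $x$ to the element with $(k,l)$-coordinate ${}_k[x]_l$ for all $(k,l)\in\mathcal{I}$. For $\mathsf{X}=\mathsf{X}_\alpha$ write $\tilde{\mathsf{X}}_\alpha,\tilde{\sigma}_\alpha,\pi_\alpha,\iota_\alpha$. *)

theory Defs
  imports "HOL-Analysis.Analysis" "HOL-Library.Omega_Words_Fun"
begin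

section \<open>Dynamical systems\<close>

definition dynamical_system :: "'a topology \<Rightarrow> ('a \<Rightarrow> 'a) \<Rightarrow> bool"
  where "dynamical_system Y S \<longleftrightarrow> continuous_map Y Y S"

definition conjugate ::
  "'a topology \<Rightarrow> ('a \<Rightarrow> 'a) \<Rightarrow> 'b topology \<Rightarrow> ('b \<Rightarrow> 'b) \<Rightarrow> bool"
  where "conjugate Y S Y' S' \<longleftrightarrow>
    dynamical_system Y S \<and> dynamical_system Y' S' \<and>
    (\<exists>h. homeomorphic_map Y Y' h \<and> (\<forall>y \<in> topspace Y. h (S y) = S' (h y)))"

text \<open>Used with index type \<^typ>\<open>nat\<close> for one-sided and \<^typ>\<open>int\<close> for two-sided sequences.\<close>

definition shift :: "('i::{plus,one} \<Rightarrow> 'a) \<Rightarrow> 'i \<Rightarrow> 'a"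
  where "shift x = (\<lambda>i. x (i + 1))"


section \<open>The cover of a one-sided shift space\<close>

text \<open>\<open>past_words X l x\<close> is the set \<open>P\<^sub>l(x)\<close>; \<open>\<frown>\<close> is concatenation of a finite and an infinite word.\<close>

definition past_words :: "(nat \<Rightarrow> 'a) set \<Rightarrow> nat \<Rightarrow> (nat \<Rightarrow> 'a) \<Rightarrow> 'a list set"
  where "past_words X l x = {\<mu>. length \<mu> = l \<and> \<mu> \<frown> x \<in> X}"

definition cover_index :: "(nat \<times> nat) set"
  where "cover_index = {(k, l). k \<le> l}"

text \<open>Only used on \<^const>\<open>cover_index\<close>, where the subtractions on \<^typ>\<open>nat\<close> do not truncate.\<close>

definition cover_index_le :: "nat \<times> nat \<Rightarrow> nat \<times> nat \<Rightarrow> bool"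
  where "cover_index_le = (\<lambda>(k1, l1) (k2, l2). k1 \<le> k2 \<and> l1 - k1 \<le> l2 - k2)"

definition cover_rel :: "(nat \<Rightarrow> 'a) set \<Rightarrow> nat \<times> nat \<Rightarrow> ((nat \<Rightarrow> 'a) \<times> (nat \<Rightarrow> 'a)) set"
  where "cover_rel X = (\<lambda>(k, l). {(x, x'). x \<in> X \<and> x' \<in> X \<and> prefix k x = prefix k x' \<and>
    past_words X l ((shift ^^ k) x) = past_words X l ((shift ^^ k) x')})"

definition cover_class :: "(nat \<Rightarrow> 'a) set \<Rightarrow> nat \<times> nat \<Rightarrow> (nat \<Rightarrow> 'a) \<Rightarrow> (nat \<Rightarrow> 'a) set"
  where "cover_class X p x = cover_rel X p `` {x}"

text \<open>An arbitrary representative of a class; the constructions below do not depend on the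
  choice (see \<open>cover_bond_class\<close> and \<open>cover_class_shift_cong\<close>).\<close>

definition class_rep :: "(nat \<Rightarrow> 'a) set \<Rightarrow> nat \<Rightarrow> 'a"
  where "class_rep C = (SOME x. x \<in> C)"

text \<open>The bonding map into the \<open>p\<close>-th quotient.\<close>

definition cover_bond :: "(nat \<Rightarrow> 'a) set \<Rightarrow> nat \<times> nat \<Rightarrow> (nat \<Rightarrow> 'a) set \<Rightarrow> (nat \<Rightarrow> 'a) set"
  where "cover_bond X p C = cover_class X p (class_rep C)"

text \<open>The projective limit is realised as the set of compatible families in the product;
  families are \<^const>\<open>undefined\<close> outside \<^const>\<open>cover_index\<close>.\<close>

definition cover :: "(nat \<Rightarrow> 'a) set \<Rightarrow> (nat \<times> nat \<Rightarrow> (nat \<Rightarrow> 'a) set) set"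
  where "cover X = {\<xi> \<in> (\<Pi>\<^sub>E p \<in> cover_index. X // cover_rel X p).
    \<forall>p \<in> cover_index. \<forall>q \<in> cover_index. cover_index_le p q \<longrightarrow> cover_bond X p (\<xi> q) = \<xi> p}"

definition cover_topology :: "(nat \<Rightarrow> 'a) set \<Rightarrow> (nat \<times> nat \<Rightarrow> (nat \<Rightarrow> 'a) set) topology"
  where "cover_topology X = subtopology
    (product_topology (\<lambda>p. discrete_topology (X // cover_rel X p)) cover_index) (cover X)"

definition cover_shift ::
  "(nat \<Rightarrow> 'a) set \<Rightarrow> (nat \<times> nat \<Rightarrow> (nat \<Rightarrow> 'a) set) \<Rightarrow> nat \<times> nat \<Rightarrow> (nat \<Rightarrow> 'a) set"
  where "cover_shift X \<xi> =
    (\<lambda>(k, l) \<in> cover_index. cover_class X (k, l) (shift (class_rep (\<xi> (k + 1, l + 1)))))"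

definition cover_proj ::
  "(nat \<Rightarrow> 'a) set \<Rightarrow> (nat \<times> nat \<Rightarrow> (nat \<Rightarrow> 'a) set) \<Rightarrow> nat \<Rightarrow> 'a"
  where "cover_proj X \<xi> = (THE x. x \<in> X \<and>
    (\<forall>(k, l) \<in> cover_index. prefix k x = prefix k (class_rep (\<xi> (k, l)))))"

definition cover_section ::
  "(nat \<Rightarrow> 'a) set \<Rightarrow> (nat \<Rightarrow> 'a) \<Rightarrow> nat \<times> nat \<Rightarrow> (nat \<Rightarrow> 'a) set"
  where "cover_section X x = (\<lambda>p \<in> cover_index. cover_class X p x)"

definition shift_orbit :: "(nat \<Rightarrow> 'a) set \<Rightarrow> (nat \<Rightarrow> 'a) \<Rightarrow> (nat \<Rightarrow> 'a) set"
  where "shift_orbit X x = (\<Union>k. \<Union>l. {y \<in> X. (shift ^^ l) y = (shift ^^ k) x})"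


subsection \<open>Independence of representatives\<close>

lemma equiv_cover_rel: "equiv X (cover_rel X p)"
  by (rule equivI) (auto simp: cover_rel_def split_beta intro!: refl_onI symI transI)

lemma cover_class_eqI: "(x, y) \<in> cover_rel X p \<Longrightarrow> cover_class X p x = cover_class X p y"
  unfolding cover_class_def by (rule equiv_class_eq[OF equiv_cover_rel])

lemma class_rep_rel:
  assumes "x \<in> X"
  shows "(x, class_rep (cover_class X p x)) \<in> cover_rel X p"
proof -
  have "x \<in> cover_class X p x"
    using assms unfolding cover_class_def by (rule equiv_class_self[OF equiv_cover_rel])
  then have "class_rep (cover_class X p x) \<in> cover_class X p x"
    unfolding class_rep_def by (rule someI[where P = "\<lambda>z. z \<in> cover_class X p x"])
  then show ?thesis
    by (simp add: cover_class_def)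
qed

lemma shift_funpow: "(shift ^^ k) x = suffix k x"
proof (induction k)
  case (Suc k)
  have "(shift ^^ Suc k) x = shift (suffix k x)"
    by (simp only: Suc funpow.simps comp_apply)
  also have "\<dots> = suffix (Suc k) x"
    by (simp add: shift_def suffix_def)
  finally show ?case .
qed simp

lemma prefix_eq_iff: "prefix k x = prefix k y \<longleftrightarrow> (\<forall>i<k. x i = y i)"
  by (auto simp: subsequence_def)

lemma past_words_tl_image:
  assumes "shift ` X = X"
  shows "past_words X l x = tl ` past_words X (Suc l) x"
proof (intro equalityI subsetI)
  fix \<mu> assume \<mu>: "\<mu> \<in> past_words X l x"
  then obtain y where y: "y \<in> X" "shift y = \<mu> \<frown> x"
    using assms unfolding past_words_def by (metis (mono_tags, lifting) imageE mem_Collect_eq)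
  have "y = (y 0 # \<mu>) \<frown> x"
  proof
    fix n
    show "y n = ((y 0 # \<mu>) \<frown> x) n"
      using fun_cong[OF y(2), of "n - 1"]
      by (cases n) (simp_all add: shift_def conc_def)
  qed
  then have "y 0 # \<mu> \<in> past_words X (Suc l) x"
    using y(1) \<mu> by (simp add: past_words_def)
  then show "\<mu> \<in> tl ` past_words X (Suc l) x"
    by force
next
  fix \<mu> assume "\<mu> \<in> tl ` past_words X (Suc l) x"
  then obtain a where a: "length \<mu> = l" "(a # \<mu>) \<frown> x \<in> X"
    by (auto simp: past_words_def length_Suc_conv)
  have "shift ((a # \<mu>) \<frown> x) = \<mu> \<frown> x"
    by (rule ext) (simp add: shift_def conc_def)
  then show "\<mu> \<in> past_words X l x"
    using a assms unfolding past_words_def by (metis (mono_tags, lifting) image_eqI mem_Collect_eq)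
qed

lemma past_words_antimono:
  assumes "shift ` X = X" "l \<le> m" "past_words X m x = past_words X m y"
  shows "past_words X l x = past_words X l y"
  using assms(2,3)
proof (induction m rule: dec_induct)
  case (step m)
  then show ?case
    using past_words_tl_image[OF assms(1)] by metis
qed simp

lemma past_words_conc:
  "past_words X l (\<nu> \<frown> x) = {\<mu>. length \<mu> = l \<and> \<mu> @ \<nu> \<in> past_words X (l + length \<nu>) x}"
  by (auto simp: past_words_def)

lemma cover_rel_mono:
  assumes X: "shift ` X = X" and p: "p \<in> cover_index" and q: "q \<in> cover_index"
    and le: "cover_index_le p q" and xy: "(x, y) \<in> cover_rel X q"
  shows "(x, y) \<in> cover_rel X p"
proof -
  obtain k l k' l' where pq: "p = (k, l)" "q = (k', l')"
    by (cases p, cases q)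
  have h: "k \<le> l" "k' \<le> l'" "k \<le> k'" "l - k \<le> l' - k'"
    using p q le by (auto simp: pq cover_index_def cover_index_le_def)
  have r: "x \<in> X" "y \<in> X" "\<forall>i<k'. x i = y i"
    "past_words X l' (suffix k' x) = past_words X l' (suffix k' y)"
    using xy by (auto simp: pq cover_rel_def prefix_eq_iff shift_funpow)
  define \<nu> where "\<nu> = map x [k..<k']"
  have len: "length \<nu> = k' - k"
    by (simp add: \<nu>_def)
  have sx: "suffix k x = \<nu> \<frown> suffix k' x"
    using h by (intro ext) (auto simp: \<nu>_def conc_def add.commute)
  have sy: "suffix k y = \<nu> \<frown> suffix k' y"
    using h r(3) by (intro ext) (auto simp: \<nu>_def conc_def add.commute)
  have "past_words X (l + length \<nu>) (suffix k' x) = past_words X (l + length \<nu>) (suffix k' y)"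
    by (rule past_words_antimono[OF X _ r(4)]) (use h len in linarith)
  then have "past_words X l (suffix k x) = past_words X l (suffix k y)"
    by (simp add: sx sy past_words_conc)
  then show ?thesis
    using r h by (auto simp: pq cover_rel_def prefix_eq_iff shift_funpow)
qed

lemma cover_bond_class:
  assumes "shift ` X = X" "p \<in> cover_index" "q \<in> cover_index" "cover_index_le p q" "x \<in> X"
  shows "cover_bond X p (cover_class X q x) = cover_class X p x"
  unfolding cover_bond_def
  by (metis assms class_rep_rel cover_rel_mono cover_class_eqI)

lemma cover_class_shift_cong:
  assumes X: "shift ` X = X" and xy: "(x, y) \<in> cover_rel X (k + 1, l + 1)"
  shows "cover_class X (k, l) (shift x) = cover_class X (k, l) (shift y)"
proof (rule cover_class_eqI)
  have s: "suffix k (shift z) = suffix (Suc k) z" for z :: "nat \<Rightarrow> 'a"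
    by (simp add: shift_def suffix_def)
  have r: "x \<in> X" "y \<in> X" "\<forall>i<Suc k. x i = y i"
    "past_words X (Suc l) (suffix (Suc k) x) = past_words X (Suc l) (suffix (Suc k) y)"
    using xy unfolding cover_rel_def by (simp_all add: prefix_eq_iff shift_funpow del: funpow.simps)
  have "past_words X l (suffix (Suc k) x) = past_words X l (suffix (Suc k) y)"
    by (rule past_words_antimono[OF X _ r(4)]) simp
  moreover have "shift x \<in> X" "shift y \<in> X"
    using X r(1,2) by blast+
  ultimately show "(shift x, shift y) \<in> cover_rel X (k, l)"
    using r(3) unfolding cover_rel_def
    by (simp add: prefix_eq_iff shift_funpow s) (simp add: shift_def)
qed


section \<open>Sturmian subshifts\<close>

text \<open>The circle is represented by \<open>[0, 1)\<close>. Sequences over \<open>{0, 1}\<close> are functions into the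
  discrete space \<^typ>\<open>nat\<close>; since the set of \<open>{0, 1}\<close>-valued sequences is closed, closures may be
  taken in the full function space, which carries the product topology.\<close>

definition rotation :: "real \<Rightarrow> real \<Rightarrow> real"
  where "rotation \<alpha> t = frac (t + \<alpha>)"

definition rotation_powi :: "real \<Rightarrow> int \<Rightarrow> real \<Rightarrow> real"
  where "rotation_powi \<alpha> i = (if 0 \<le> i then rotation \<alpha> ^^ nat i
    else inv_into {0..<1} (rotation \<alpha>) ^^ nat (- i))"

definition sturmian_code :: "real \<Rightarrow> real \<Rightarrow> nat"
  where "sturmian_code \<alpha> t = (if t < 1 - \<alpha> then 0 else 1)"

definition sturmian1 :: "real \<Rightarrow> (nat \<Rightarrow> nat) set"
  where "sturmian1 \<alpha> =
    closure {(\<lambda>i. sturmian_code \<alpha> ((rotation \<alpha> ^^ i) t)) | t. t \<in> {0..<1}}"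

definition sturmian2 :: "real \<Rightarrow> (int \<Rightarrow> nat) set"
  where "sturmian2 \<alpha> =
    closure {(\<lambda>i. sturmian_code \<alpha> (rotation_powi \<alpha> i t)) | t. t \<in> {0..<1}}"

definition truncation :: "(int \<Rightarrow> 'a) \<Rightarrow> nat \<Rightarrow> 'a"
  where "truncation x = (\<lambda>n. x (int n))"

definition branch_point :: "real \<Rightarrow> nat \<Rightarrow> nat"
  where "branch_point \<alpha> = (THE x. x \<in> sturmian1 \<alpha> \<and>
    (\<exists>y \<in> sturmian1 \<alpha>. \<exists>z \<in> sturmian1 \<alpha>. y \<noteq> z \<and> shift y = x \<and> shift z = x))"

definition cover_nonisolated :: "real \<Rightarrow> (nat \<times> nat \<Rightarrow> (nat \<Rightarrow> nat) set) set"
  where "cover_nonisolated \<alpha> = cover (sturmian1 \<alpha>) -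
    cover_section (sturmian1 \<alpha>) ` shift_orbit (sturmian1 \<alpha>) (branch_point \<alpha>)"

lemma rotation_powi_eq:
  assumes "t \<in> {0..<1}"
  shows "rotation_powi \<alpha> i t = frac (t + of_int i * \<alpha>)"
proof -
  have frac_add: "frac (frac u + v) = frac (u + v)" for u v :: real
    unfolding frac_def by (simp add: floor_diff_of_int algebra_simps)
  have pos: "(rotation \<alpha> ^^ n) t = frac (t + of_nat n * \<alpha>)" for n
  proof (induction n)
    case 0
    then show ?case using assms by (simp add: frac_eq)
  next
    case (Suc n)
    then show ?case by (simp add: rotation_def frac_add algebra_simps)
  qed
  have inj: "inj_on (rotation \<alpha>) {0..<1}"
  proof (rule inj_on_inverseI)
    fix s :: real assume "s \<in> {0..<1}"
    then show "rotation (- \<alpha>) (rotation \<alpha> s) = s"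
      by (simp add: rotation_def frac_add[of "s + \<alpha>" "- \<alpha>", simplified] frac_eq)
  qed
  have inv: "inv_into {0..<1} (rotation \<alpha>) (frac u) = frac (u - \<alpha>)" for u
  proof (rule inv_into_f_eq[OF inj])
    show "frac (u - \<alpha>) \<in> {0..<1}" by (simp add: frac_lt_1)
    show "rotation \<alpha> (frac (u - \<alpha>)) = frac u" by (simp add: rotation_def frac_add)
  qed
  have neg: "(inv_into {0..<1} (rotation \<alpha>) ^^ n) t = frac (t - of_nat n * \<alpha>)" for n
  proof (induction n)
    case 0
    then show ?case using assms by (simp add: frac_eq)
  next
    case (Suc n)
    then show ?case by (simp add: inv algebra_simps)
  qed
  show ?thesis
    by (auto simp: rotation_powi_def pos neg)
qed

end

theory Submission
  imports Defs
begin

text \<open>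
  Sturmian sequences are the mechanical words \<open>i \<mapsto> f (t + (i + 1)\<alpha>) - f (t + i\<alpha>)\<close>, where \<open>f\<close> is
  the floor function or its left-continuous version. Density of the multiples of \<open>\<alpha>\<close> modulo
  \<open>1\<close> shows that a one-sided tail determines \<open>t\<close> modulo \<open>1\<close>, and the two choices of \<open>f\<close> lead to a
  branching only at \<open>t \<in> \<int>\<close>, so there is exactly one branch point \<open>\<omega>\<close>.

  If two distinct words \<open>\<mu>, \<mu>'\<close> of length \<open>l\<close> can precede \<open>\<sigma>\<^sup>k(x)\<close>, then cutting their common
  suffix off \<open>\<omega>\<close> yields \<open>\<sigma>\<^sup>k(x)\<close>, so the class of \<open>x\<close> is \<open>{x}\<close> and \<open>x\<close> lies in the orbit of
  \<open>\<omega>\<close>; a point of the cover passing through such a class is therefore isolated and equal to the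
  section at \<open>x\<close>. All other points of the cover prescribe exactly one past of each length, and
  thus correspond to two-sided sequences.
\<close>

section \<open>Sequence spaces\<close>

lemma open_cylinder:
  fixes x :: "'i \<Rightarrow> 'a::discrete_topology"
  assumes "finite I"
  shows "open {y. \<forall>i\<in>I. y i = x i}"
proof -
  have "open (\<Inter>i\<in>I. (\<lambda>y. y i) -` {x i})"
    using assms by (intro open_INT ballI open_vimage open_discrete) auto
  moreover have "{y. \<forall>i\<in>I. y i = x i} = (\<Inter>i\<in>I. (\<lambda>y. y i) -` {x i})"
    by auto
  ultimately show ?thesis
    by simp
qed

lemma open_contains_cylinder:
  fixes x :: "int \<Rightarrow> 'a::topological_space"
  assumes "open T" "x \<in> T"
  obtains n :: nat where "\<And>y. (\<And>i. \<bar>i\<bar> \<le> int n \<Longrightarrow> y i = x i) \<Longrightarrow> y \<in> T"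
proof -
  obtain U where U: "x \<in> Pi\<^sub>E UNIV U" "\<And>i. open (U i)" "finite {i. U i \<noteq> UNIV}" "Pi\<^sub>E UNIV U \<subseteq> T"
    using product_topology_open_contains_basis[of "\<lambda>_. euclidean" UNIV T x] assms
    by (auto simp: euclidean_product_topology open_openin[symmetric])
  \<comment> \<open>A bound for the finitely many restricted coordinates; the inserted 0 keeps the
    maximum defined when no coordinate is restricted.\<close>
  define n where "n = nat (Max (insert 0 (abs ` {i. U i \<noteq> UNIV})))"
  have n: "\<bar>i\<bar> \<le> int n" if "U i \<noteq> UNIV" for i
    using U(3) that Max_ge[of "insert 0 (abs ` {i. U i \<noteq> UNIV})" "\<bar>i\<bar>"] by (simp add: n_def)
  show thesis
  proof (rule that)
    fix y assume "\<And>i. \<bar>i\<bar> \<le> int n \<Longrightarrow> y i = x i"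
    then have "y \<in> Pi\<^sub>E UNIV U"
      using U(1) n by (auto simp: PiE_iff) (metis UNIV_I)
    with U(4) show "y \<in> T"
      by blast
  qed
qed

text \<open>The Hausdorff property passes from the factors to the function space through its
  identification with the product topology.\<close>

lemma compact_fun_imp_closed:
  fixes K :: "('i \<Rightarrow> 'a::t2_space) set"
  assumes "compact K"
  shows "closed K"
proof -
  have "Hausdorff_space (euclidean :: 'a topology)"
    using hausdorff by (auto simp: Hausdorff_space_def disjnt_def)
  then have "Hausdorff_space (euclidean :: ('i \<Rightarrow> 'a) topology)"
    by (simp add: Hausdorff_space_product_topology flip: euclidean_product_topology)
  then show ?thesis
    using compactin_imp_closedin[of euclidean K] assms by simp
qed

text \<open>Two-sidedness gives surjectivity: moving a sequence one place to the right uncovers a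
  symbol in front of its truncation.\<close>

lemma shift_image_truncation:
  fixes L :: "(int \<Rightarrow> 'a) set"
  assumes "\<And>x m. x \<in> L \<Longrightarrow> (\<lambda>i. x (i + m)) \<in> L"
  shows "shift ` truncation ` L = truncation ` L"
proof (intro equalityI subsetI)
  fix y assume "y \<in> shift ` truncation ` L"
  then obtain x where x: "x \<in> L" "y = shift (truncation x)"
    by blast
  have "y = truncation (\<lambda>i. x (i + 1))"
    by (simp add: x(2) shift_def truncation_def add.commute)
  with assms[OF x(1)] show "y \<in> truncation ` L"
    by blast
next
  fix y assume "y \<in> truncation ` L"
  then obtain x where x: "x \<in> L" "y = truncation x"
    by blast
  have "y = shift (truncation (\<lambda>i. x (i + (- 1))))"
    by (simp add: x(2) shift_def truncation_def)
  with assms[OF x(1)] show "y \<in> shift ` truncation ` L"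
    by blast
qed


section \<open>Shift spaces with a single branch point\<close>

lemma cover_coord:
  assumes "\<xi> \<in> cover X" "p \<in> cover_index"
  obtains y where "y \<in> X" "\<xi> p = cover_class X p y"
proof -
  have "\<xi> p \<in> X // cover_rel X p"
    using assms by (auto simp: cover_def)
  then show thesis
    using that by (auto simp: quotient_def cover_class_def)
qed

lemma cover_bondD:
  assumes "\<xi> \<in> cover X" "p \<in> cover_index" "q \<in> cover_index" "cover_index_le p q"
  shows "cover_bond X p (\<xi> q) = \<xi> p"
  using assms by (simp add: cover_def)

lemma cover_undefined:
  assumes "\<xi> \<in> cover X" "p \<notin> cover_index"
  shows "\<xi> p = undefined"
  using PiE_arb[of \<xi> cover_index "\<lambda>p. X // cover_rel X p" p] assms by (simp add: cover_def)

text \<open>Collects what the Sturmian system contributes to the analysis of its cover. The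
  assumption \<open>dense\<close> serves two ends: approximants off the orbit of
  \<open>\<omega>\<close> turn coordinates of \<open>embed x\<close> into classes of actual points,
  and approximants distinct from \<open>x\<close> show that \<open>embed x\<close> is not
  isolated.\<close>

locale branched_shift =
  fixes L :: "(int \<Rightarrow> 'a::discrete_topology) set"
    and X :: "(nat \<Rightarrow> 'a) set"
    and \<omega> :: "nat \<Rightarrow> 'a"
  assumes compact_L: "compact L"
    and translate: "x \<in> L \<Longrightarrow> (\<lambda>i. x (i + m)) \<in> L"
    and X_eq: "X = truncation ` L"
    and branch: "\<exists>y\<in>X. \<exists>z\<in>X. y \<noteq> z \<and> shift y = \<omega> \<and> shift z = \<omega>"
    and branch_unique: "y \<in> X \<Longrightarrow> z \<in> X \<Longrightarrow> y \<noteq> z \<Longrightarrow> shift y = shift z \<Longrightarrow> shift y = \<omega>"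
    and dense: "x \<in> L \<Longrightarrow>
      \<exists>y\<in>L. y \<noteq> x \<and> (\<forall>i. \<bar>i\<bar> \<le> int n \<longrightarrow> y i = x i) \<and> truncation y \<notin> shift_orbit X \<omega>"
begin

text \<open>The \<open>l\<close> symbols just before position \<open>k\<close>; for
  \<open>k \<le> l\<close> they cover positions 0 to \<open>k - 1\<close> and reach
  \<open>l - k\<close> places to the left of 0.\<close>

abbreviation window :: "(int \<Rightarrow> 'a) \<Rightarrow> nat \<Rightarrow> nat \<Rightarrow> 'a list"
  where "window x k l \<equiv> map x [int k - int l..int k - 1]"

text \<open>\<open>embed x\<close> records the limit of the classes of points whose only past is that of \<open>x\<close>;
  it differs from the section at the truncation of \<open>x\<close> exactly over the orbit of \<open>\<omega>\<close>.\<close>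

definition embed :: "(int \<Rightarrow> 'a) \<Rightarrow> nat \<times> nat \<Rightarrow> (nat \<Rightarrow> 'a) set"
  where "embed x = (\<lambda>(k, l) \<in> cover_index. {y \<in> X. prefix k y = prefix k (truncation x) \<and>
    past_words X l (suffix k y) = {window x k l}})"

lemma shift_X: "shift ` X = X"
  unfolding X_eq by (rule shift_image_truncation) (rule translate)

lemma suffix_X: "x \<in> X \<Longrightarrow> suffix k x \<in> X"
proof (induction k)
  case (Suc k)
  then have "shift (suffix k x) \<in> X"
    using shift_X by blast
  then show ?case
    by (simp add: shift_def suffix_def)
qed simp

lemma truncation_X: "x \<in> L \<Longrightarrow> truncation x \<in> X"
  by (simp add: X_eq)

section \<open>Pasts of a point and the branch point\<close>

text \<open>Through this identity, translation invariance of \<open>L\<close> makes every window an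
  admissible past.\<close>

lemma window_conc:
  "window x k l \<frown> suffix k (truncation x) = truncation (\<lambda>i. x (i + (int k - int l)))"
proof
  fix n
  show "(window x k l \<frown> suffix k (truncation x)) n = truncation (\<lambda>i. x (i + (int k - int l))) n"
    by (cases "n < l") (auto simp: conc_def truncation_def algebra_simps of_nat_diff)
qed

lemma window_past:
  assumes "x \<in> L"
  shows "window x k l \<in> past_words X l (suffix k (truncation x))"
  using truncation_X[OF translate[OF assms, of "int k - int l"]]
  by (simp add: past_words_def window_conc)

text \<open>Two distinct pasts of \<open>y\<close> branch at \<open>\<omega>\<close>, so \<open>y\<close> is recovered by cutting their longest
  common suffix off \<open>\<omega>\<close>.\<close>

lemma past_words_branch:
  assumes "\<mu> \<noteq> \<mu>'" "length \<mu> = length \<mu>'"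
  obtains j where "\<And>y. \<mu> \<frown> y \<in> X \<Longrightarrow> \<mu>' \<frown> y \<in> X \<Longrightarrow> y = suffix j \<omega>"
proof -
  \<comment> \<open>Reversal turns the common suffix into a common prefix, so that the first
    disagreement found is the last one in the original words.\<close>
  have "rev \<mu> \<noteq> rev \<mu>'" "length (rev \<mu>) = length (rev \<mu>')"
    using assms by auto
  from same_length_different[OF this]
  obtain \<nu> c \<beta> d \<gamma> where
    cd: "c \<noteq> d" "rev \<mu> = \<nu> @ [c] @ \<beta>" "rev \<mu>' = \<nu> @ [d] @ \<gamma>"
    by blast
  have \<mu>: "\<mu> = rev \<beta> @ c # rev \<nu>" "\<mu>' = rev \<gamma> @ d # rev \<nu>"
    using arg_cong[OF cd(2), of rev] arg_cong[OF cd(3), of rev] by simp_all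
  have "y = suffix (length \<nu>) \<omega>" if "\<mu> \<frown> y \<in> X" "\<mu>' \<frown> y \<in> X" for y
  proof -
    have suf: "suffix (length \<delta>) ((\<delta> @ \<eta>) \<frown> y) = \<eta> \<frown> y" for \<delta> \<eta> :: "'a list"
      by (metis conc_conc suffix_conc_length)
    \<comment> \<open>Cutting both sequences at the last disagreement leaves two distinct shift
      preimages of \<open>rev \<nu> \<frown> y\<close>, which therefore is
      \<open>\<omega>\<close>.\<close>
    have "(c # rev \<nu>) \<frown> y \<in> X" "(d # rev \<nu>) \<frown> y \<in> X"
      using suffix_X[OF that(1), of "length (rev \<beta>)"] suffix_X[OF that(2), of "length (rev \<gamma>)"]
      unfolding \<mu> suf by auto
    moreover have "(c # rev \<nu>) \<frown> y \<noteq> (d # rev \<nu>) \<frown> y"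
      using cd(1) by simp
    moreover have sh: "shift ((e # rev \<nu>) \<frown> y) = rev \<nu> \<frown> y" for e
      by (rule ext) (simp add: shift_def conc_def)
    ultimately have "rev \<nu> \<frown> y = \<omega>"
      using branch_unique by metis
    then show ?thesis
      by (metis length_rev suffix_conc_length)
  qed
  then show thesis
    by (rule that)
qed

text \<open>A second past of the same length would, by \<open>past_words_branch\<close>, make
  \<open>y\<close> a tail of \<open>\<omega>\<close>.\<close>

lemma past_words_singleton:
  assumes "y \<in> X" "y \<notin> range (\<lambda>j. suffix j \<omega>)" "\<mu> \<in> past_words X l y"
  shows "past_words X l y = {\<mu>}"
proof -
  have "\<mu>' = \<mu>" if "\<mu>' \<in> past_words X l y" for \<mu>'
  proof (rule ccontr)
    assume "\<mu>' \<noteq> \<mu>"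
    moreover have "length \<mu>' = length \<mu>"
      using that assms(3) by (simp add: past_words_def)
    ultimately obtain j where "\<mu>' \<frown> y \<in> X \<Longrightarrow> \<mu> \<frown> y \<in> X \<Longrightarrow> y = suffix j \<omega>"
      using past_words_branch by metis
    then show False
      using that assms by (auto simp: past_words_def)
  qed
  then show ?thesis
    using assms(3) by blast
qed

lemma shift_orbit_iff: "y \<in> shift_orbit X \<omega> \<longleftrightarrow> y \<in> X \<and> (\<exists>k j. suffix k y = suffix j \<omega>)"
  by (auto simp: shift_orbit_def shift_funpow)

section \<open>Embedding the two-sided system into the cover\<close>

lemma embed_apply:
  assumes "(k, l) \<in> cover_index"
  shows "embed x (k, l) = {y \<in> X. prefix k y = prefix k (truncation x) \<and>
    past_words X l (suffix k y) = {window x k l}}"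
  using assms by (simp add: embed_def)

lemma embed_past:
  assumes "(k, l) \<in> cover_index" "y \<in> embed x (k, l)"
  shows "past_words X l (suffix k y) = {window x k l}"
  using assms by (simp add: embed_def)

text \<open>The window is always admissible, so a unique past has to be the window, and the
  conditions defining \<open>embed\<close> become those defining the class.\<close>

lemma embed_eq_class:
  assumes "x \<in> L" "k \<le> l" "past_words X l (suffix k (truncation x)) = {w}"
  shows "embed x (k, l) = cover_class X (k, l) (truncation x)"
proof -
  have "w = window x k l"
    using window_past[OF assms(1), of k l] assms(3) by simp
  then show ?thesis
    using assms truncation_X[OF assms(1)]
    by (auto simp: embed_def cover_index_def cover_class_def cover_rel_def shift_funpow)
qed

text \<open>Coordinate \<open>(k, l)\<close> inspects \<open>x\<close> only at positions from
  \<open>k - l\<close> to \<open>k - 1\<close>, all within distance \<open>n\<close> of 0 because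
  \<open>k \<le> l \<le> n\<close>. This is the source of continuity.\<close>

lemma embed_local:
  assumes "\<And>i. \<bar>i\<bar> \<le> int n \<Longrightarrow> y i = x i" "l \<le> n" "(k, l) \<in> cover_index"
  shows "embed y (k, l) = embed x (k, l)"
proof -
  have "window y k l = window x k l"
    using assms by (auto simp: cover_index_def)
  moreover have "prefix k (truncation y) = prefix k (truncation x)"
    using assms by (auto simp: prefix_eq_iff truncation_def cover_index_def)
  ultimately show ?thesis
    by (simp only: embed_apply[OF assms(3)])
qed

text \<open>No tail of a point off the orbit is a tail of \<open>\<omega>\<close>, so all its tails
  have unique pasts.\<close>

lemma embed_eq_class_off_orbit:
  assumes "x \<in> L" "truncation x \<notin> shift_orbit X \<omega>" "(k, l) \<in> cover_index"
  shows "embed x (k, l) = cover_class X (k, l) (truncation x)"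
proof (rule embed_eq_class)
  show "k \<le> l"
    using assms(3) by (simp add: cover_index_def)
  have "suffix k (truncation x) \<notin> range (\<lambda>j. suffix j \<omega>)"
    using assms(2) truncation_X[OF assms(1)] unfolding shift_orbit_iff by blast
  from past_words_singleton[OF suffix_X[OF truncation_X[OF assms(1)]] this window_past[OF assms(1)]]
  show "past_words X l (suffix k (truncation x)) = {window x k l}" .
qed fact

text \<open>Replacing \<open>x\<close> by a nearby point off the orbit changes none of the
  coordinates up to \<open>n\<close>. Hence finitely many coordinates of \<open>embed x\<close> are
  classes of one common point, from which nonemptiness and compatibility are inherited.\<close>

lemma embed_approx:
  assumes "x \<in> L"
  obtains y where "y \<in> X" "\<And>k l. l \<le> n \<Longrightarrow> (k, l) \<in> cover_index \<Longrightarrow>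
    embed x (k, l) = cover_class X (k, l) y"
proof -
  obtain y where y: "y \<in> L" "\<And>i. \<bar>i\<bar> \<le> int n \<Longrightarrow> y i = x i" "truncation y \<notin> shift_orbit X \<omega>"
    using dense[OF assms] by meson
  show thesis
  proof (rule that[of "truncation y"])
    show "truncation y \<in> X"
      using y(1) by (rule truncation_X)
    fix k l assume kl: "l \<le> n" "(k, l) \<in> cover_index"
    show "embed x (k, l) = cover_class X (k, l) (truncation y)"
      using embed_local[OF y(2) kl] embed_eq_class_off_orbit[OF y(1,3) kl(2)] by simp
  qed
qed

lemma embed_nonempty:
  assumes "x \<in> L" "p \<in> cover_index"
  shows "class_rep (embed x p) \<in> embed x p"
proof -
  obtain k l where p: "p = (k, l)"
    by fastforce
  obtain y where "y \<in> X" "embed x p = cover_class X p y"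
    using embed_approx[OF assms(1), of l] assms(2) p by (metis order_refl)
  then have "y \<in> embed x p"
    unfolding cover_class_def using equiv_class_self[OF equiv_cover_rel] by metis
  then show ?thesis
    unfolding class_rep_def by (rule someI[where P = "\<lambda>z. z \<in> embed x p"])
qed

lemma embed_in_cover:
  assumes "x \<in> L"
  shows "embed x \<in> cover X"
  unfolding cover_def
proof (intro CollectI conjI ballI impI)
  show "embed x \<in> (\<Pi>\<^sub>E p\<in>cover_index. X // cover_rel X p)"
  proof (rule PiE_I)
    fix p :: "nat \<times> nat" assume "p \<in> cover_index"
    moreover obtain k l where "p = (k, l)"
      by fastforce
    ultimately obtain y where "y \<in> X" "embed x p = cover_class X p y"
      using embed_approx[OF assms, of l] by (metis order_refl)
    then show "embed x p \<in> X // cover_rel X p"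
      by (simp add: cover_class_def quotientI)
  qed (simp add: embed_def)
next
  fix p q :: "nat \<times> nat"
  assume pq: "p \<in> cover_index" "q \<in> cover_index" "cover_index_le p q"
  obtain k l k' l' where kl: "p = (k, l)" "q = (k', l')"
    by fastforce
  obtain y where y: "y \<in> X" "embed x p = cover_class X p y" "embed x q = cover_class X q y"
    using embed_approx[OF assms, of "max l l'"] pq(1,2) unfolding kl by (metis max.cobounded1 max.cobounded2)
  show "cover_bond X p (embed x q) = embed x p"
    unfolding y(2,3) by (rule cover_bond_class[OF shift_X pq y(1)])
qed

lemma inj_on_embed: "inj_on embed L"
proof (rule inj_onI, rule ext)
  fix x y and i :: int
  assume xy: "x \<in> L" "y \<in> L" "embed x = embed y"
  \<comment> \<open>The window of index \<open>(k, 2 * k)\<close> runs from \<open>- k\<close> to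
    \<open>k - 1\<close>, so this choice makes it contain \<open>i\<close>.\<close>
  define k where "k = nat \<bar>i\<bar> + 1"
  have p: "(k, 2 * k) \<in> cover_index"
    by (simp add: cover_index_def)
  have "class_rep (embed x (k, 2 * k)) \<in> embed x (k, 2 * k)"
    by (rule embed_nonempty[OF xy(1) p])
  moreover from this have "class_rep (embed x (k, 2 * k)) \<in> embed y (k, 2 * k)"
    unfolding xy(3) .
  ultimately have "window x k (2 * k) = window y k (2 * k)"
    by (metis embed_past p singleton_inject)
  then have "\<forall>j\<in>{int k - int (2 * k)..int k - 1}. x j = y j"
    by (simp add: map_eq_conv)
  moreover have "i \<in> {int k - int (2 * k)..int k - 1}"
    by (auto simp: k_def)
  ultimately show "x i = y i"
    by blast
qed

lemma embed_shift:
  assumes "x \<in> L"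
  shows "embed (shift x) = cover_shift X (embed x)"
proof
  fix p :: "nat \<times> nat"
  obtain k l where p: "p = (k, l)"
    by fastforce
  show "embed (shift x) p = cover_shift X (embed x) p"
  proof (cases "p \<in> cover_index")
    case False
    then show ?thesis
      by (simp add: embed_def cover_shift_def)
  next
    case True
    then have q: "(k + 1, l + 1) \<in> cover_index"
      by (simp add: p cover_index_def)
    define r where "r = class_rep (embed x (k + 1, l + 1))"
    have "r \<in> embed x (k + 1, l + 1)"
      unfolding r_def by (rule embed_nonempty[OF assms q])
    then have r: "r \<in> X" "\<forall>i<k + 1. r i = truncation x i"
      "past_words X (Suc l) (suffix (Suc k) r) = {window x (Suc k) (Suc l)}"
      using q by (simp_all add: embed_def prefix_eq_iff)
    \<comment> \<open>Passing from \<open>(k + 1, l + 1)\<close> to \<open>(k, l)\<close> forgets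
      the oldest symbol of the past, and deleting it yields the window of the shifted
      sequence.\<close>
    have w: "tl (window x (Suc k) (Suc l)) = window (shift x) k l"
      by (rule nth_equalityI) (auto simp: nth_tl shift_def algebra_simps)
    have "suffix (Suc k) r = suffix k (shift r)"
      by (simp add: shift_def suffix_def)
    with r(3) w have "past_words X l (suffix k (shift r)) = {window (shift x) k l}"
      using past_words_tl_image[OF shift_X, of l "suffix (Suc k) r"] by simp
    moreover have "shift r \<in> X"
      using r(1) shift_X by blast
    moreover have "prefix k (shift r) = prefix k (truncation (shift x))"
      using r(2) by (auto simp: prefix_eq_iff shift_def truncation_def add.commute)
    ultimately have "embed (shift x) p = cover_class X p (shift r)"
      using True by (auto simp: p embed_def cover_class_def cover_rel_def shift_funpow)
    then show ?thesis
      using True by (simp add: p cover_shift_def r_def)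
  qed
qed

lemma cover_proj_embed:
  assumes "x \<in> L"
  shows "cover_proj X (embed x) = truncation x"
  unfolding cover_proj_def
proof (rule the_equality)
  have rep: "prefix k (class_rep (embed x (k, l))) = prefix k (truncation x)"
    if "(k, l) \<in> cover_index" for k l
    using embed_nonempty[OF assms that] that by (simp add: embed_def)
  then show "truncation x \<in> X \<and>
    (\<forall>(k, l)\<in>cover_index. prefix k (truncation x) = prefix k (class_rep (embed x (k, l))))"
    using truncation_X[OF assms] by auto
  fix y
  assume y: "y \<in> X \<and> (\<forall>(k, l)\<in>cover_index. prefix k y = prefix k (class_rep (embed x (k, l))))"
  show "y = truncation x"
  proof
    fix n
    \<comment> \<open>The smallest prefix length that sees position \<open>n\<close>.\<close>
    have "(Suc n, Suc n) \<in> cover_index"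
      by (simp add: cover_index_def)
    then have "prefix (Suc n) y = prefix (Suc n) (truncation x)"
      using y rep by fastforce
    then show "y n = truncation x n"
      unfolding prefix_eq_iff by blast
  qed
qed

section \<open>Continuity of the embedding\<close>

lemma topspace_cover_topology: "topspace (cover_topology X) = cover X"
  unfolding cover_topology_def by (auto simp: cover_def)

lemma continuous_embed: "continuous_map (top_of_set L) (cover_topology X) embed"
  unfolding cover_topology_def continuous_map_in_subtopology continuous_map_componentwise
proof (intro conjI ballI)
  show "embed ` topspace (top_of_set L) \<subseteq> extensional cover_index"
    by (auto simp: embed_def)
  show "embed \<in> topspace (top_of_set L) \<rightarrow> cover X"
    using embed_in_cover by auto
  fix p :: "nat \<times> nat" assume p: "p \<in> cover_index"
  obtain k l where kl: "p = (k, l)"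
    by fastforce
  show "continuous_map (top_of_set L) (discrete_topology (X // cover_rel X p)) (\<lambda>x. embed x p)"
    unfolding continuous_map
  proof (intro conjI allI impI)
    show "(\<lambda>x. embed x p) ` topspace (top_of_set L) \<subseteq> topspace (discrete_topology (X // cover_rel X p))"
      using embed_in_cover p by (auto simp: cover_def)
    fix U
    show "openin (top_of_set L) {x \<in> topspace (top_of_set L). embed x p \<in> U}"
    proof (subst openin_subopen, intro ballI)
      fix x assume x: "x \<in> {x \<in> topspace (top_of_set L). embed x p \<in> U}"
      \<comment> \<open>A cylinder around \<open>x\<close> wide enough for
        \<open>embed_local\<close>, so that the coordinate \<open>p\<close> is constant on
        it.\<close>
      define T where "T = L \<inter> {y. \<forall>i\<in>{- int l..int l}. y i = x i}"
      have embed_const: "embed y p = embed x p" if "y \<in> T" for y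
        unfolding kl
        by (rule embed_local[of l]) (use that p in \<open>auto simp: T_def kl abs_le_iff\<close>)
      have "openin (top_of_set L) T"
        unfolding T_def by (intro openin_open_Int open_cylinder) simp
      moreover have "x \<in> T"
        using x by (simp add: T_def)
      moreover have "T \<subseteq> {x \<in> topspace (top_of_set L). embed x p \<in> U}"
      proof
        fix y assume "y \<in> T"
        then show "y \<in> {x \<in> topspace (top_of_set L). embed x p \<in> U}"
          using x embed_const[of y] by (simp add: T_def)
      qed
      ultimately show "\<exists>T. openin (top_of_set L) T \<and> x \<in> T \<and>
        T \<subseteq> {x \<in> topspace (top_of_set L). embed x p \<in> U}"
        by blast
    qed
  qed
qed

section \<open>Points of the cover on and off the branch orbit\<close>

text \<open>Two pasts pin down the tail of every member of the class as the same
  \<open>suffix j \<omega>\<close>, and the prefix of length \<open>k\<close> is shared as well, so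
  the class is a singleton. Compatibility then propagates this one point to all other
  coordinates.\<close>

lemma cover_eq_section:
  assumes \<xi>: "\<xi> \<in> cover X" and p: "(k, l) \<in> cover_index" "\<xi> (k, l) = cover_class X (k, l) x" "x \<in> X"
    and nonsing: "\<mu> \<in> past_words X l (suffix k x)" "\<mu>' \<in> past_words X l (suffix k x)" "\<mu> \<noteq> \<mu>'"
  shows "\<xi> (k, l) = {x}" "x \<in> shift_orbit X \<omega>" "\<xi> = cover_section X x"
proof -
  obtain j where j: "\<And>y. \<mu> \<frown> y \<in> X \<Longrightarrow> \<mu>' \<frown> y \<in> X \<Longrightarrow> y = suffix j \<omega>"
    using past_words_branch[OF nonsing(3)] nonsing(1,2) by (auto simp: past_words_def)
  have xj: "suffix k x = suffix j \<omega>"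
    using j[of "suffix k x"] nonsing(1,2) by (simp add: past_words_def)
  then show "x \<in> shift_orbit X \<omega>"
    using p(3) shift_orbit_iff by blast
  have unique: "y = x" if "(x, y) \<in> cover_rel X (k, l)" for y
  proof -
    have y: "prefix k y = prefix k x" "past_words X l (suffix k y) = past_words X l (suffix k x)"
      using that by (auto simp: cover_rel_def shift_funpow)
    then have "suffix k y = suffix j \<omega>"
      using j[of "suffix k y"] nonsing(1,2) by (auto simp: past_words_def)
    with y(1) xj show ?thesis
      by (metis prefix_suffix)
  qed
  have "(x, x) \<in> cover_rel X (k, l)"
    using p(3) by (simp add: cover_rel_def)
  then show px: "\<xi> (k, l) = {x}"
    using unique p(2) by (auto simp: cover_class_def)
  show "\<xi> = cover_section X x"
  proof
    fix q :: "nat \<times> nat"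
    obtain k' l' where q: "q = (k', l')"
      by fastforce
    show "\<xi> q = cover_section X x q"
    proof (cases "q \<in> cover_index")
      case False
      then show ?thesis
        using cover_undefined[OF \<xi>] by (simp add: cover_section_def)
    next
      case True
      \<comment> \<open>The index \<open>(m, 2 * m)\<close> dominates both \<open>(k, l)\<close> and
        \<open>q\<close>.\<close>
      define m where "m = max l l'"
      have m: "(m, 2 * m) \<in> cover_index" "cover_index_le (k, l) (m, 2 * m)"
        "cover_index_le q (m, 2 * m)"
        using True p(1) by (auto simp: m_def cover_index_def cover_index_le_def q)
      obtain z where z: "z \<in> X" "\<xi> (m, 2 * m) = cover_class X (m, 2 * m) z"
        using cover_coord[OF \<xi> m(1)] .
      have bond: "\<xi> q = cover_class X q z"
        if "q \<in> cover_index" "cover_index_le q (m, 2 * m)" for q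
        using cover_bondD[OF \<xi> that(1) m(1) that(2)]
          cover_bond_class[OF shift_X that(1) m(1) that(2) z(1)] by (simp add: z(2))
      \<comment> \<open>A representative of the dominating coordinate also lies in the singleton
        \<open>\<xi> (k, l)\<close>, hence equals \<open>x\<close>.\<close>
      have "z \<in> \<xi> (k, l)"
        unfolding bond[OF p(1) m(2)] cover_class_def
        by (rule equiv_class_self[OF equiv_cover_rel z(1)])
      then show ?thesis
        using bond[OF True m(3)] True px by (simp add: cover_section_def)
    qed
  qed
qed

text \<open>Each single coordinate is realised by some element of \<open>L\<close>; compactness of
  \<open>L\<close> then gives one element that realises all of them.\<close>

lemma cover_decomp:
  assumes \<xi>: "\<xi> \<in> cover X" and notsec: "\<xi> \<notin> cover_section X ` shift_orbit X \<omega>"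
  shows "\<xi> \<in> embed ` L"
proof -
  have approx: "\<exists>x\<in>L. embed x p = \<xi> p" if p: "p \<in> cover_index" for p
  proof -
    obtain k l where kl: "p = (k, l)"
      by fastforce
    obtain y where y: "y \<in> X" "\<xi> p = cover_class X p y"
      using cover_coord[OF \<xi> p] .
    then obtain x where x: "x \<in> L" "y = truncation x"
      by (auto simp: X_eq)
    \<comment> \<open>Any past besides the window would make \<open>\<xi>\<close> a section over the
      orbit by \<open>cover_eq_section\<close>.\<close>
    have "past_words X l (suffix k y) = {window x k l}"
      using cover_eq_section[OF \<xi> _ _ y(1), of k l _ "window x k l"] window_past[OF x(1), of k l]
        notsec p y(2) x(2) kl by blast
    then show ?thesis
      using embed_eq_class[OF x(1), of k l] x y(2) p by (auto simp: kl cover_index_def)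
  qed
  \<comment> \<open>The indices \<open>(n, 2 * n)\<close> are cofinal, and by compatibility the sets
    \<open>K n\<close> decrease with \<open>n\<close>; this yields the finite intersection
    property.\<close>
  define K where "K n = {x \<in> L. embed x (n, 2 * n) = \<xi> (n, 2 * n)}" for n
  have idx: "(n, 2 * n) \<in> cover_index" for n
    by (simp add: cover_index_def)
  have bond: "embed x p = \<xi> p"
    if "x \<in> K n" "p \<in> cover_index" "cover_index_le p (n, 2 * n)" for x p n
  proof -
    have "x \<in> L" "embed x (n, 2 * n) = \<xi> (n, 2 * n)"
      using that(1) by (auto simp: K_def)
    then show ?thesis
      using cover_bondD[OF embed_in_cover that(2) idx that(3)] cover_bondD[OF \<xi> that(2) idx that(3)]
      by metis
  qed
  have closed_K: "closed (K n)" for n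
  proof -
    have "closedin (discrete_topology (X // cover_rel X (n, 2 * n))) {\<xi> (n, 2 * n)}"
      using \<xi> idx by (auto simp: cover_def)
    then have "closedin (top_of_set L) (K n)"
      unfolding K_def using closedin_continuous_map_preimage[of "top_of_set L"
        "discrete_topology (X // cover_rel X (n, 2 * n))" "\<lambda>x. embed x (n, 2 * n)" "{\<xi> (n, 2 * n)}"]
        continuous_embed idx[of n]
      unfolding cover_topology_def continuous_map_in_subtopology continuous_map_componentwise
      by auto
    then show ?thesis
      by (rule closedin_closed_trans[OF _ compact_fun_imp_closed[OF compact_L]])
  qed
  have "L \<inter> \<Inter> (K ` N) \<noteq> {}" if "finite N" for N
  proof -
    define m where "m = Max (insert 0 N)"
    obtain x where x: "x \<in> K m"
      using approx[OF idx[of m]] by (auto simp: K_def)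
    have "x \<in> K n" if "n \<in> N" for n
    proof -
      have "n \<le> m"
        using that \<open>finite N\<close> by (simp add: m_def)
      then show ?thesis
        using bond[OF x idx[of n]] x by (simp add: K_def cover_index_le_def)
    qed
    then show ?thesis
      using x by (fastforce simp: K_def)
  qed
  then have "L \<inter> \<Inter> (range K) \<noteq> {}"
    using compact_imp_fip_image[OF compact_L, of UNIV K] closed_K by blast
  then obtain x where "x \<in> L \<inter> \<Inter> (range K)"
    by (meson ex_in_conv)
  then have x: "x \<in> L" "\<And>n. x \<in> K n"
    by simp_all
  have "embed x = \<xi>"
  proof
    fix p :: "nat \<times> nat"
    show "embed x p = \<xi> p"
    proof (cases "p \<in> cover_index")
      case True
      then show ?thesis
        using bond[OF x(2)[of "snd p"] True] by (auto simp: cover_index_def cover_index_le_def)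
    next
      case False
      then show ?thesis
        using cover_undefined[OF \<xi>] by (simp add: embed_def)
    qed
  qed
  with x(1) show ?thesis
    by blast
qed

text \<open>A point of the orbit shares a tail with \<open>\<omega>\<close>, and the two preimages
  of \<open>\<omega>\<close> supply different symbols in front of the part cut off.\<close>

lemma orbit_nonsingleton:
  assumes "x \<in> shift_orbit X \<omega>"
  obtains k l \<mu> \<mu>' where "(k, l) \<in> cover_index" "\<mu> \<noteq> \<mu>'"
    "\<mu> \<in> past_words X l (suffix k x)" "\<mu>' \<in> past_words X l (suffix k x)"
proof -
  obtain k j where kj: "suffix k x = suffix j \<omega>"
    using assms shift_orbit_iff by blast
  obtain y z where yz: "y \<in> X" "z \<in> X" "y \<noteq> z" "shift y = \<omega>" "shift z = \<omega>"
    using branch by blast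
  obtain y' z' where yz': "y' \<in> L" "z' \<in> L" "y = truncation y'" "z = truncation z'"
    using yz(1,2) by (auto simp: X_eq)
  \<comment> \<open>With this length the window before position \<open>Suc j\<close> runs from
    \<open>- k\<close> to \<open>j\<close>. It contains position 0, the only place where
    \<open>y\<close> and \<open>z\<close> differ, and \<open>k \<le> l\<close> holds.\<close>
  define l where "l = k + j + 1"
  define u where "u x = window x (Suc j) l" for x :: "int \<Rightarrow> 'a"
  have "suffix (Suc j) v = suffix j (shift v)" for v :: "nat \<Rightarrow> 'a"
    by (simp add: shift_def suffix_def)
  then have suf: "suffix k x = suffix (Suc j) y" "suffix k x = suffix (Suc j) z"
    by (simp_all add: kj yz(4,5))
  have "u y' \<noteq> u z'"
  proof
    assume "u y' = u z'"
    then have "\<forall>i\<in>{int (Suc j) - int l..int (Suc j) - 1}. y' i = z' i"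
      by (simp add: u_def map_eq_conv)
    then have "y' 0 = z' 0"
      by (simp add: l_def)
    then have "y 0 = z 0"
      by (simp add: yz' truncation_def)
    moreover have "y (Suc n) = z (Suc n)" for n
      using fun_cong[OF yz(4), of n] fun_cong[OF yz(5), of n] by (simp add: shift_def)
    ultimately have "y = z"
      using not0_implies_Suc by (metis ext)
    with yz(3) show False
      by simp
  qed
  moreover have "u y' \<in> past_words X l (suffix k x)" "u z' \<in> past_words X l (suffix k x)"
    using window_past[OF yz'(1), of "Suc j" l] window_past[OF yz'(2), of "Suc j" l]
    by (simp_all only: u_def suf flip: yz'(3,4)) (simp_all flip: suf)
  moreover have "(k, l) \<in> cover_index"
    by (simp add: l_def cover_index_def)
  ultimately show thesis
    using that by blast
qed

text \<open>The section contains \<open>x\<close> itself in a coordinate where \<open>x\<close> has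
  two pasts, whereas members of \<open>embed y\<close> have exactly one.\<close>

lemma section_not_embed:
  assumes "x \<in> shift_orbit X \<omega>" "y \<in> L"
  shows "cover_section X x \<noteq> embed y"
proof
  assume eq: "cover_section X x = embed y"
  obtain k l \<mu> \<mu>' where kl: "(k, l) \<in> cover_index" "\<mu> \<noteq> \<mu>'"
    "\<mu> \<in> past_words X l (suffix k x)" "\<mu>' \<in> past_words X l (suffix k x)"
    using orbit_nonsingleton[OF assms(1)] .
  have "x \<in> X"
    using assms(1) by (simp add: shift_orbit_iff)
  then have "x \<in> cover_section X x (k, l)"
    using kl(1) by (simp add: cover_section_def cover_class_def cover_rel_def)
  then have "past_words X l (suffix k x) = {window y k l}"
    using kl(1) by (simp add: eq embed_def)
  with kl show False
    by auto
qed

lemma cover_minus_orbit: "cover X - cover_section X ` shift_orbit X \<omega> = embed ` L"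
proof (intro equalityI subsetI)
  fix \<xi> assume "\<xi> \<in> embed ` L"
  then show "\<xi> \<in> cover X - cover_section X ` shift_orbit X \<omega>"
    using embed_in_cover section_not_embed by (metis (no_types, lifting) DiffI imageE)
qed (simp add: cover_decomp)

section \<open>Nonisolated points and the conjugacy\<close>

lemma derived_set_cover: "cover_topology X derived_set_of cover X = embed ` L"
proof (intro equalityI subsetI)
  fix \<xi> assume \<xi>: "\<xi> \<in> cover_topology X derived_set_of cover X"
  then have cov: "\<xi> \<in> cover X"
    by (simp add: in_derived_set_of topspace_cover_topology)
  moreover have "\<xi> \<notin> cover_section X ` shift_orbit X \<omega>"
  proof
    assume "\<xi> \<in> cover_section X ` shift_orbit X \<omega>"
    then obtain x where x: "x \<in> shift_orbit X \<omega>" "\<xi> = cover_section X x"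
      by blast
    have xX: "x \<in> X"
      using x(1) by (simp add: shift_orbit_iff)
    obtain k l \<mu> \<mu>' where kl: "(k, l) \<in> cover_index" "\<mu> \<noteq> \<mu>'"
      "\<mu> \<in> past_words X l (suffix k x)" "\<mu>' \<in> past_words X l (suffix k x)"
      using orbit_nonsingleton[OF x(1)] .
    \<comment> \<open>Prescribing one coordinate with two pasts is an open condition, and by
      \<open>cover_eq_section\<close> it leaves only \<open>\<xi>\<close>.\<close>
    define T where "T = {\<eta> \<in> topspace (cover_topology X). \<eta> (k, l) \<in> {\<xi> (k, l)}}"
    have "continuous_map (cover_topology X) (discrete_topology (X // cover_rel X (k, l))) (\<lambda>\<eta>. \<eta> (k, l))"
      unfolding cover_topology_def
      by (intro continuous_map_from_subtopology continuous_map_product_projection kl(1))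
    then have "openin (cover_topology X) T"
      unfolding T_def using cov kl(1)
      by (intro openin_continuous_map_preimage) (auto simp: cover_def)
    moreover have "\<eta> = \<xi>" if "\<eta> \<in> T" for \<eta>
    proof -
      have "\<eta> (k, l) = cover_class X (k, l) x"
        using that kl(1) by (simp add: T_def x(2) cover_section_def)
      then show ?thesis
        using cover_eq_section(3)[OF _ kl(1) _ xX kl(3,4,2)] that x(2)
        by (simp add: T_def topspace_cover_topology)
    qed
    moreover have "\<xi> \<in> T"
      using cov by (simp add: T_def topspace_cover_topology)
    moreover from \<xi> have "\<forall>T. \<xi> \<in> T \<and> openin (cover_topology X) T \<longrightarrow> (\<exists>\<eta>. \<eta> \<noteq> \<xi> \<and> \<eta> \<in> cover X \<and> \<eta> \<in> T)"
      unfolding in_derived_set_of by (rule conjunct2)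
    ultimately show False
      by metis
  qed
  ultimately show "\<xi> \<in> embed ` L"
    by (rule cover_decomp)
next
  fix \<xi> assume "\<xi> \<in> embed ` L"
  then obtain x where x: "x \<in> L" "\<xi> = embed x"
    by blast
  show "\<xi> \<in> cover_topology X derived_set_of cover X"
    unfolding in_derived_set_of topspace_cover_topology
  proof (intro conjI allI impI)
    show "\<xi> \<in> cover X"
      using x embed_in_cover by simp
    fix T assume T: "\<xi> \<in> T \<and> openin (cover_topology X) T"
    \<comment> \<open>A neighbourhood in the cover is pulled back to \<open>L\<close>, where
      \<open>dense\<close> provides a different point inside it.\<close>
    then have "openin (top_of_set L) {y \<in> L. embed y \<in> T}"
      using openin_continuous_map_preimage[OF continuous_embed] by simp
    then obtain U where U: "open U" "{y \<in> L. embed y \<in> T} = L \<inter> U"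
      by (auto simp: openin_open)
    have "x \<in> U"
      using T x U(2) by blast
    with U(1) obtain n where n: "\<And>y. (\<And>i. \<bar>i\<bar> \<le> int n \<Longrightarrow> y i = x i) \<Longrightarrow> y \<in> U"
      using open_contains_cylinder by metis
    obtain y where y: "y \<in> L" "y \<noteq> x" "\<And>i. \<bar>i\<bar> \<le> int n \<Longrightarrow> y i = x i"
      using dense[OF x(1)] by meson
    have "embed y \<in> T"
      using n[OF y(3)] y(1) U(2) by blast
    moreover have "embed y \<noteq> \<xi>"
      using inj_on_embed x y(1,2) by (auto dest: inj_onD)
    ultimately show "\<exists>y. y \<noteq> \<xi> \<and> y \<in> cover X \<and> y \<in> T"
      using embed_in_cover[OF y(1)] by blast
  qed
qed

lemma Hausdorff_cover: "Hausdorff_space (cover_topology X)"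
  unfolding cover_topology_def
  by (intro Hausdorff_space_subtopology)
    (simp add: Hausdorff_space_product_topology Hausdorff_space_discrete_topology)

lemma shift_L: "x \<in> L \<Longrightarrow> shift x \<in> L"
  using translate[of x 1] by (simp add: shift_def)

text \<open>A continuous injection from a compact space into a Hausdorff space is a homeomorphism
  onto its image.\<close>

lemma conjugate_embed:
  "conjugate (subtopology (cover_topology X) (embed ` L)) (cover_shift X) (top_of_set L) shift"
proof -
  let ?E = "subtopology (cover_topology X) (embed ` L)"
  have top: "topspace ?E = embed ` L"
    using embed_in_cover by (auto simp: topspace_cover_topology)
  have "homeomorphic_map (top_of_set L) ?E embed"
  proof (rule continuous_imp_homeomorphic_map)
    show "continuous_map (top_of_set L) ?E embed"
      using continuous_embed by (simp add: continuous_map_in_subtopology)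
    show "compact_space (top_of_set L)"
      using compact_L by (simp add: compact_space_subtopology)
    show "Hausdorff_space ?E"
      by (rule Hausdorff_space_subtopology[OF Hausdorff_cover])
  qed (use top inj_on_embed in auto)
  then obtain h where h: "homeomorphic_maps (top_of_set L) ?E embed h"
    by (auto simp: homeomorphic_map_maps)
  have hom: "homeomorphic_map ?E (top_of_set L) h"
    using h homeomorphic_maps_sym homeomorphic_map_maps by blast
  have inv: "h (embed x) = x" if "x \<in> L" for x
    using h that by (auto simp: homeomorphic_maps_def)
  have cont: "continuous_map (top_of_set L) (top_of_set L) shift"
  proof -
    have "continuous_on L (shift :: (int \<Rightarrow> 'a) \<Rightarrow> _)"
      unfolding shift_def
      by (intro continuous_on_coordinatewise_then_product
        continuous_on_subset[OF continuous_on_product_coordinates]) simp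
    then show ?thesis
      using shift_L by (auto simp: continuous_map_in_subtopology)
  qed
  \<comment> \<open>Continuity of \<open>cover_shift\<close> on the image is transported from the
    two-sided shift through \<open>embed\<close> and its inverse \<open>h\<close>.\<close>
  have "continuous_map ?E ?E (embed \<circ> (shift \<circ> h))"
  proof (rule continuous_map_compose, rule continuous_map_compose)
    show "continuous_map ?E (top_of_set L) h" "continuous_map (top_of_set L) ?E embed"
      using h by (simp_all only: homeomorphic_maps_def)
  qed (rule cont)
  then have "continuous_map ?E ?E (cover_shift X)"
  proof (rule continuous_map_eq)
    fix \<xi> assume "\<xi> \<in> topspace ?E"
    then show "(embed \<circ> (shift \<circ> h)) \<xi> = cover_shift X \<xi>"
      using inv embed_shift unfolding top by auto
  qed
  moreover have "\<forall>\<xi>\<in>topspace ?E. h (cover_shift X \<xi>) = shift (h \<xi>)"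
    unfolding top using inv shift_L by (auto simp: embed_shift[symmetric])
  ultimately show ?thesis
    unfolding conjugate_def dynamical_system_def using cont hom by blast
qed

end

section \<open>Mechanical words\<close>

text \<open>\<open>sided_floor True\<close> and \<open>sided_floor False\<close> are the right- and left-continuous versions
  of the floor function; they yield the lower and upper mechanical words of slope \<open>\<alpha>\<close>.\<close>

definition sided_floor :: "bool \<Rightarrow> real \<Rightarrow> int"
  where "sided_floor u t = (if u then \<lfloor>t\<rfloor> else \<lceil>t\<rceil> - 1)"

definition mechanical :: "real \<Rightarrow> bool \<Rightarrow> real \<Rightarrow> int \<Rightarrow> nat"
  where "mechanical \<alpha> u t i =
    nat (sided_floor u (t + of_int (i + 1) * \<alpha>) - sided_floor u (t + of_int i * \<alpha>))"

text \<open>The open half-line along which \<open>sided_floor u\<close> is continuous at its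
  endpoint \<open>t\<close>.\<close>

definition side :: "bool \<Rightarrow> real \<Rightarrow> real set"
  where "side u t = (if u then {t<..} else {..<t})"

lemma sided_floor_add_int: "sided_floor u (t + of_int m) = sided_floor u t + m"
  by (simp add: sided_floor_def ceiling_add_of_int)

lemma sided_floor_mono: "s \<le> t \<Longrightarrow> sided_floor u s \<le> sided_floor u t"
  using floor_mono[of s t] ceiling_mono[of s t] by (auto simp: sided_floor_def)

lemma sided_floor_le: "of_int (sided_floor u t) \<le> t"
  unfolding sided_floor_def using ceiling_correct[of t] by auto

lemma sided_floor_ge: "t \<le> of_int (sided_floor u t) + 1"
  unfolding sided_floor_def using floor_correct[of t] by auto

lemma sided_floor_nonint:
  assumes "t \<notin> \<int>"
  shows "sided_floor u t = \<lfloor>t\<rfloor>"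
proof -
  have "t \<noteq> of_int \<lfloor>t\<rfloor>"
    using assms by (metis Ints_of_int)
  then show ?thesis
    by (simp add: sided_floor_def ceiling_altdef)
qed

lemma sided_floor_int: "t \<in> \<int> \<Longrightarrow> sided_floor u t = (if u then \<lfloor>t\<rfloor> else \<lfloor>t\<rfloor> - 1)"
  by (auto simp: sided_floor_def elim: Ints_cases)

section \<open>One-sided limits of mechanical words\<close>

text \<open>Strictly beside \<open>t\<close> and close to it, \<open>s + c\<close> lies between
  consecutive integers, where both versions of the floor agree with the limit from side
  \<open>u\<close>.\<close>

lemma eventually_sided_floor:
  "eventually (\<lambda>s. \<forall>v. sided_floor v (s + c) = sided_floor u (t + c)) (at t within side u t)"
proof (cases u)
  case True
  have "eventually (\<lambda>s. s \<in> {t<..<of_int \<lfloor>t + c\<rfloor> + 1 - c}) (at_right t)"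
    by (rule eventually_at_right_real) linarith
  then have "eventually (\<lambda>s. \<forall>v. sided_floor v (s + c) = sided_floor u (t + c)) (at_right t)"
  proof (rule eventually_mono)
    fix s assume "s \<in> {t<..<of_int \<lfloor>t + c\<rfloor> + 1 - c}"
    then have "of_int \<lfloor>t + c\<rfloor> < s + c" "s + c < of_int \<lfloor>t + c\<rfloor> + 1"
      using floor_correct[of "t + c"] unfolding greaterThanLessThan_iff by linarith+
    then have "\<lfloor>s + c\<rfloor> = \<lfloor>t + c\<rfloor>" "\<lceil>s + c\<rceil> = \<lfloor>t + c\<rfloor> + 1"
      unfolding floor_eq_iff ceiling_eq_iff by auto
    then show "\<forall>v. sided_floor v (s + c) = sided_floor u (t + c)"
      by (simp add: sided_floor_def True)
  qed
  then show ?thesis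
    by (simp add: side_def True)
next
  case False
  have "eventually (\<lambda>s. s \<in> {of_int \<lceil>t + c\<rceil> - 1 - c<..<t}) (at_left t)"
    by (rule eventually_at_left_real) linarith
  then have "eventually (\<lambda>s. \<forall>v. sided_floor v (s + c) = sided_floor u (t + c)) (at_left t)"
  proof (rule eventually_mono)
    fix s assume "s \<in> {of_int \<lceil>t + c\<rceil> - 1 - c<..<t}"
    then have "of_int \<lceil>t + c\<rceil> - 1 < s + c" "s + c < of_int \<lceil>t + c\<rceil>"
      using ceiling_correct[of "t + c"] unfolding greaterThanLessThan_iff by linarith+
    then have "\<lfloor>s + c\<rfloor> = \<lceil>t + c\<rceil> - 1" "\<lceil>s + c\<rceil> = \<lceil>t + c\<rceil>"
      unfolding floor_eq_iff ceiling_eq_iff by auto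
    then show "\<forall>v. sided_floor v (s + c) = sided_floor u (t + c)"
      by (simp add: sided_floor_def False)
  qed
  then show ?thesis
    by (simp add: side_def False)
qed

lemma eventually_mechanical:
  "eventually (\<lambda>s. \<forall>i. \<bar>i\<bar> \<le> int n \<longrightarrow> (\<forall>v. mechanical \<alpha> v s i = mechanical \<alpha> u t i))
    (at t within side u t)"
proof -
  \<comment> \<open>The upper end is \<open>n + 1\<close> because the symbol at \<open>i\<close>
    also involves the floor at \<open>i + 1\<close>.\<close>
  have "eventually (\<lambda>s. \<forall>i\<in>{- int n..int n + 1}. \<forall>v.
      sided_floor v (s + of_int i * \<alpha>) = sided_floor u (t + of_int i * \<alpha>)) (at t within side u t)"
    by (intro eventually_ball_finite ballI eventually_sided_floor) simp
  then show ?thesis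
  proof (rule eventually_mono)
    fix s assume s: "\<forall>i\<in>{- int n..int n + 1}. \<forall>v.
      sided_floor v (s + of_int i * \<alpha>) = sided_floor u (t + of_int i * \<alpha>)"
    show "\<forall>i. \<bar>i\<bar> \<le> int n \<longrightarrow> (\<forall>v. mechanical \<alpha> v s i = mechanical \<alpha> u t i)"
    proof (intro allI impI)
      fix i v assume "\<bar>i\<bar> \<le> int n"
      then have "i \<in> {- int n..int n + 1}" "i + 1 \<in> {- int n..int n + 1}"
        by auto
      with s show "mechanical \<alpha> v s i = mechanical \<alpha> u t i"
        by (simp only: mechanical_def)
    qed
  qed
qed

text \<open>One-sided neighbourhoods contain an open interval, which is uncountable.\<close>

lemma eventually_side_avoid_countable:
  assumes "eventually P (at t within side u t)" "countable C"
  obtains s where "P s" "s \<notin> C"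
proof -
  have "\<exists>a b. a < b \<and> (\<forall>s\<in>{a<..<b}. P s)"
  proof (cases u)
    case True
    then obtain b where "t < b" "\<forall>s>t. s < b \<longrightarrow> P s"
      using assms(1) by (auto simp: side_def eventually_at_right_field)
    then show ?thesis
      by (intro exI[of _ t] exI[of _ b]) simp
  next
    case False
    then obtain a where "a < t" "\<forall>s>a. s < t \<longrightarrow> P s"
      using assms(1) by (auto simp: side_def eventually_at_left_field)
    then show ?thesis
      by (intro exI[of _ a] exI[of _ t]) simp
  qed
  then obtain a b where ab: "a < b" "\<And>s. s \<in> {a<..<b} \<Longrightarrow> P s"
    by blast
  have "\<not> {a<..<b} \<subseteq> C"
    using uncountable_open_interval[of a b] ab(1) assms(2) countable_subset by blast
  then show thesis
    using that ab(2) by blast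
qed

lemma mechanical_translate: "mechanical \<alpha> u t (i + m) = mechanical \<alpha> u (t + of_int m * \<alpha>) i"
  by (simp add: mechanical_def algebra_simps)

lemma mechanical_add_int: "mechanical \<alpha> u (t + of_int m) = mechanical \<alpha> u t"
proof
  fix i
  have "sided_floor u (t + of_int m + c) = sided_floor u (t + c) + m" for c
    using sided_floor_add_int[of u "t + c" m] by (simp add: add_ac)
  then show "mechanical \<alpha> u (t + of_int m) i = mechanical \<alpha> u t i"
    unfolding mechanical_def by simp
qed

section \<open>Recovering the parameter of a code from its tail\<close>

locale irrational_slope =
  fixes \<alpha> :: real
  assumes \<alpha>: "\<alpha> \<in> {0<..<1} - \<rat>"
begin

abbreviation code :: "bool \<Rightarrow> real \<Rightarrow> int \<Rightarrow> nat"
  where "code \<equiv> mechanical \<alpha>"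

text \<open>As \<open>\<alpha>\<close> is positive, the floor differences are nonnegative and the
  conversion by \<open>nat\<close> loses nothing.\<close>

lemma int_code:
  "int (code u t i) = sided_floor u (t + of_int (i + 1) * \<alpha>) - sided_floor u (t + of_int i * \<alpha>)"
  using sided_floor_mono[of "t + of_int i * \<alpha>" "t + of_int (i + 1) * \<alpha>" u] \<alpha>
  by (simp add: mechanical_def algebra_simps)

lemma code_le_1: "code u t i \<le> 1"
proof -
  have "of_int (i + 1) * \<alpha> = of_int i * \<alpha> + \<alpha>"
    by (simp add: algebra_simps)
  then have "sided_floor u (t + of_int (i + 1) * \<alpha>) \<le> sided_floor u (t + of_int i * \<alpha> + of_int 1)"
    using \<alpha> by (intro sided_floor_mono) simp
  then have "int (code u t i) \<le> 1"
    unfolding int_code sided_floor_add_int by simp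
  then show ?thesis
    by simp
qed

lemma int_mult_\<alpha>_in_Ints: "of_int i * \<alpha> \<in> \<int> \<longleftrightarrow> i = 0"
proof
  assume "of_int i * \<alpha> \<in> \<int>"
  then obtain m where m: "of_int i * \<alpha> = of_int m"
    by (elim Ints_cases)
  show "i = 0"
  proof (rule ccontr)
    assume "i \<noteq> 0"
    with m have "\<alpha> = of_int m / of_int i"
      by (simp add: field_simps)
    then have "\<alpha> \<in> \<rat>"
      by simp
    with \<alpha> show False
      by simp
  qed
qed simp

text \<open>Density of the multiples of \<open>\<alpha>\<close> modulo 1 moves an integer strictly
  between the two translated points, so the sides \<open>u\<close> and \<open>v\<close> do not
  matter.\<close>

lemma sided_floor_separates:
  assumes "s < t"
  obtains i where "i \<ge> n" "sided_floor u (s + of_int i * \<alpha>) < sided_floor v (t + of_int i * \<alpha>)"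
proof -
  define N where "N = max n 0"
  \<comment> \<open>If \<open>k * \<alpha>\<close> is close to \<open>c\<close> modulo 1, then the
    midpoint of the translates of \<open>s\<close> and \<open>t\<close> by
    \<open>(N + k) * \<alpha>\<close> is close to an integer.\<close>
  define c where "c = - (s + t) / 2 - of_int N * \<alpha>"
  have "0 \<le> frac c" "frac c \<le> 1" "(t - s) / 2 > 0" "\<alpha> \<notin> \<rat>"
    using assms \<alpha> frac_lt_1[of c] by auto
  then obtain k where k: "\<bar>frac (real k * \<alpha>) - frac c\<bar> < (t - s) / 2"
    using Kronecker_approx_1_explicit by metis
  define M where "M = \<lfloor>real k * \<alpha>\<rfloor> - \<lfloor>c\<rfloor>"
  define i where "i = N + int k"
  have "frac (real k * \<alpha>) - frac c = real k * \<alpha> - c - of_int M"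
    by (simp add: frac_def M_def)
  with k have "- ((t - s) / 2) < real k * \<alpha> - c - of_int M" "real k * \<alpha> - c - of_int M < (t - s) / 2"
    by linarith+
  moreover have "of_int i * \<alpha> = real k * \<alpha> + of_int N * \<alpha>"
    by (simp add: i_def algebra_simps)
  ultimately have "s + of_int i * \<alpha> < of_int M" "of_int M < t + of_int i * \<alpha>"
    unfolding c_def by (simp_all add: field_simps)
  then have "real_of_int (sided_floor u (s + of_int i * \<alpha>)) < real_of_int M"
    "real_of_int M < real_of_int (sided_floor v (t + of_int i * \<alpha>) + 1)"
    using sided_floor_le[of u "s + of_int i * \<alpha>"] sided_floor_ge[of "t + of_int i * \<alpha>" v]
    unfolding of_int_add of_int_1 by linarith+
  then have "sided_floor u (s + of_int i * \<alpha>) < sided_floor v (t + of_int i * \<alpha>)"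
    unfolding of_int_less_iff by linarith
  moreover have "i \<ge> n"
    by (simp add: i_def N_def)
  ultimately show thesis
    using that by blast
qed

text \<open>Codes record increments of floors, so equal tails keep the difference of the floors at a
  constant \<open>d\<close>. Once \<open>d\<close> is absorbed into \<open>t\<close>, the floors
  agree from \<open>n\<close> on, and \<open>sided_floor_separates\<close> rules out distinct
  parameters.\<close>

lemma code_eq_imp:
  assumes "\<And>i. i \<ge> n \<Longrightarrow> code u s i = code v t i"
  obtains m where "s = t + of_int m"
proof -
  define d where "d = sided_floor u (s + of_int n * \<alpha>) - sided_floor v (t + of_int n * \<alpha>)"
  have "sided_floor u (s + of_int i * \<alpha>) - sided_floor v (t + of_int i * \<alpha>) = d" if "i \<ge> n" for i
    using that
  proof (induction i rule: int_ge_induct)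
    case (step i)
    then show ?case
      using assms[of i] int_code[of u s i] int_code[of v t i] by simp
  qed (simp add: d_def)
  then have eq: "sided_floor u (s + of_int i * \<alpha>) = sided_floor v (t + of_int d + of_int i * \<alpha>)"
    if "i \<ge> n" for i
    using that sided_floor_add_int[of v "t + of_int i * \<alpha>" d] by (simp add: algebra_simps)
  have "s = t + of_int d"
  proof (rule linorder_cases)
    assume "s < t + of_int d"
    from sided_floor_separates[OF this, of n u v] eq show ?thesis
      by (metis less_irrefl)
  next
    assume "t + of_int d < s"
    from sided_floor_separates[OF this, of n v u] eq show ?thesis
      by (metis less_irrefl)
  qed
  then show thesis
    by (rule that)
qed

text \<open>The parameter approaches \<open>t\<close> from side \<open>u\<close>. Avoiding also the
  integer translates of \<open>t\<close> makes the codes distinct by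
  \<open>code_eq_imp\<close>.\<close>

lemma code_approx:
  assumes "countable C"
  obtains s where "s \<notin> C" "code True s \<noteq> code u t" "\<And>i. \<bar>i\<bar> \<le> int n \<Longrightarrow> code True s i = code u t i"
proof -
  have "countable (C \<union> range (\<lambda>m. t + of_int m))"
    using assms by simp
  then obtain s where s: "\<forall>i. \<bar>i\<bar> \<le> int n \<longrightarrow> (\<forall>v. code v s i = code u t i)"
    "s \<notin> C \<union> range (\<lambda>m. t + of_int m)"
    using eventually_side_avoid_countable[OF eventually_mechanical] by metis
  have "code True s \<noteq> code u t"
  proof
    assume "code True s = code u t"
    then obtain m where "s = t + of_int m"
      using code_eq_imp[of 0 True s u t] by metis
    with s(2) show False
      by blast
  qed
  with s show thesis
    by (intro that) auto
qed

section \<open>Sturmian subshifts as spaces of mechanical words\<close>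

lemma sturmian_code_frac: "sturmian_code \<alpha> (frac s) = nat (\<lfloor>s + \<alpha>\<rfloor> - \<lfloor>s\<rfloor>)"
proof (cases "frac s < 1 - \<alpha>")
  case True
  then have "\<lfloor>s + \<alpha>\<rfloor> = \<lfloor>s\<rfloor>"
    using \<alpha> by (simp add: floor_eq_iff frac_def) linarith
  with True show ?thesis
    by (simp add: sturmian_code_def)
next
  case False
  then have "\<lfloor>s + \<alpha>\<rfloor> = \<lfloor>s\<rfloor> + 1"
    using \<alpha> by (simp add: floor_eq_iff frac_def) linarith
  with False show ?thesis
    by (simp add: sturmian_code_def)
qed

lemma coding_eq:
  assumes "t \<in> {0..<1}"
  shows "(\<lambda>i. sturmian_code \<alpha> (rotation_powi \<alpha> i t)) = code True t"
proof
  fix i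
  show "sturmian_code \<alpha> (rotation_powi \<alpha> i t) = code True t i"
    unfolding rotation_powi_eq[OF assms] sturmian_code_frac
    by (simp add: mechanical_def sided_floor_def algebra_simps)
qed

lemma sturmian2_closure: "sturmian2 \<alpha> = closure (range (code True))"
proof -
  have "{(\<lambda>i. sturmian_code \<alpha> (rotation_powi \<alpha> i t)) | t. t \<in> {0..<1}} = code True ` {0..<1}"
    using coding_eq by (auto simp: image_def) metis+
  also have "\<dots> = range (code True)"
  proof (intro equalityI subsetI)
    fix x assume "x \<in> range (code True)"
    then obtain t where "x = code True t"
      by blast
    then have "x = code True (frac t)"
      using mechanical_add_int[of \<alpha> True "frac t" "\<lfloor>t\<rfloor>"] by (simp add: frac_def)
    then show "x \<in> code True ` {0..<1}"
      by (auto simp: frac_lt_1)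
  qed auto
  finally show ?thesis
    by (simp add: sturmian2_def)
qed

text \<open>The words of the left-continuous floor arise as limits of codes with right-continuous
  floor whose parameters increase to \<open>t\<close>.\<close>

lemma code_in_sturmian2: "code u t \<in> sturmian2 \<alpha>"
proof (rule ccontr)
  assume "code u t \<notin> sturmian2 \<alpha>"
  then have "code u t \<in> - closure (range (code True))" "open (- closure (range (code True)))"
    by (auto simp: sturmian2_closure)
  then obtain n where "\<And>y. (\<And>i. \<bar>i\<bar> \<le> int n \<Longrightarrow> y i = code u t i) \<Longrightarrow> y \<in> - closure (range (code True))"
    using open_contains_cylinder by metis
  moreover obtain s where "\<And>i. \<bar>i\<bar> \<le> int n \<Longrightarrow> code True s i = code u t i"
    using code_approx[of "{}" u t n] by auto
  ultimately have "code True s \<in> - closure (range (code True))"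
    by blast
  then show False
    using closure_subset[of "range (code True)"] by blast
qed

text \<open>The parameters of approximating codes subconverge to some \<open>t\<close>; the side
  from which they do so selects \<open>u\<close>.\<close>

lemma sturmian2_imp_code:
  assumes "x \<in> sturmian2 \<alpha>"
  obtains u t where "x = code u t"
proof -
  have "\<exists>t. t \<in> {0..1} \<and> (\<forall>i. \<bar>i\<bar> \<le> int n \<longrightarrow> code True t i = x i)" for n
  proof -
    define T where "T = {y. \<forall>i\<in>{- int n..int n}. y i = x i}"
    have "open T" "x \<in> T"
      by (auto simp: T_def intro: open_cylinder)
    then have "T \<inter> range (code True) \<noteq> {}"
      using assms open_Int_closure_eq_empty[of T "range (code True)"] by (auto simp: sturmian2_closure)
    then obtain t where "code True t \<in> T"
      by blast
    moreover have "code True t = code True (frac t)"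
      using mechanical_add_int[of \<alpha> True "frac t" "\<lfloor>t\<rfloor>"] by (simp add: frac_def)
    ultimately have "code True (frac t) \<in> T"
      by simp
    then show ?thesis
      by (intro exI[of _ "frac t"]) (auto simp: T_def abs_le_iff frac_ge_0 less_imp_le[OF frac_lt_1])
  qed
  then obtain \<theta> where \<theta>: "\<And>n. \<theta> n \<in> {0..1}" "\<And>n i. \<bar>i\<bar> \<le> int n \<Longrightarrow> code True (\<theta> n) i = x i"
    by metis
  obtain t r where tr: "strict_mono r" "(\<theta> \<circ> r) \<longlonglongrightarrow> t"
    using compact_Icc[of 0 "1::real"] \<theta>(1) unfolding compact_eq_seq_compact_metric seq_compact_def by metis
  have late: "\<forall>\<^sub>F n in sequentially. code True (\<theta> (r n)) i = x i" for i
    using eventually_ge_at_top[of "nat \<bar>i\<bar>"]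
  proof (rule eventually_mono)
    fix n assume "nat \<bar>i\<bar> \<le> n"
    then show "code True (\<theta> (r n)) i = x i"
      using \<theta>(2)[of i "r n"] seq_suble[OF tr(1), of n] by linarith
  qed
  \<comment> \<open>Visiting one side infinitely often suffices: each symbol of \<open>x\<close> is
    then compared with the one-sided limit at a single late index.\<close>
  have oneside: "x = code u t" if freq: "\<exists>\<^sub>F n in sequentially. \<theta> (r n) \<in> side u t" for u
  proof
    fix i
    have "\<forall>\<^sub>F s in nhds t. s \<in> side u t \<longrightarrow> code True s i = code u t i"
      using eventually_mechanical[of "nat \<bar>i\<bar>" \<alpha> u t] unfolding eventually_at_filter
      by (rule eventually_mono) (auto simp: side_def split: if_splits)
    then have "\<forall>\<^sub>F n in sequentially. \<theta> (r n) \<in> side u t \<longrightarrow> code True (\<theta> (r n)) i = code u t i"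
      using tr(2) unfolding filterlim_iff by auto
    with late[of i] have "\<forall>\<^sub>F n in sequentially. \<theta> (r n) \<in> side u t \<longrightarrow> x i = code u t i"
      by eventually_elim auto
    then show "x i = code u t i"
      using frequently_eventually_frequently[OF freq] frequently_ex by blast
  qed
  show thesis
  proof (cases "\<exists>u. \<exists>\<^sub>F n in sequentially. \<theta> (r n) \<in> side u t")
    case True
    then show thesis
      using oneside that by blast
  next
    \<comment> \<open>With neither side visited infinitely often, the parameters are eventually
      equal to \<open>t\<close>.\<close>
    case False
    then have "\<forall>\<^sub>F n in sequentially. \<theta> (r n) \<notin> side True t" "\<forall>\<^sub>F n in sequentially. \<theta> (r n) \<notin> side False t"
      by (auto simp: frequently_def)
    then have eq: "\<forall>\<^sub>F n in sequentially. \<theta> (r n) = t"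
      by eventually_elim (simp add: side_def)
    have "x i = code True t i" for i
    proof -
      have "\<forall>\<^sub>F n in sequentially. x i = code True t i"
        using eq late[of i] by eventually_elim simp
      then show ?thesis
        by simp
    qed
    then show thesis
      using that by blast
  qed
qed

lemma compact_sturmian2: "compact (sturmian2 \<alpha>)"
proof -
  define B :: "(int \<Rightarrow> nat) set" where "B = (\<Pi>\<^sub>E i\<in>UNIV. {0, 1})"
  have "compactin (product_topology (\<lambda>_. euclidean) UNIV) B"
    unfolding B_def by (simp add: compactin_PiE)
  then have B: "compact B"
    by (simp add: euclidean_product_topology)
  have "code True t i \<in> {0, 1}" for t i
    using code_le_1[of True t i] by auto
  then have "range (code True) \<subseteq> B"
    unfolding B_def PiE_UNIV_domain by (intro image_subsetI Pi_I)
  then have "sturmian2 \<alpha> \<subseteq> B"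
    unfolding sturmian2_closure by (rule closure_minimal) (rule compact_fun_imp_closed[OF B])
  moreover have "closed (sturmian2 \<alpha>)"
    by (simp add: sturmian2_closure)
  ultimately show ?thesis
    using compact_Int_closed[OF B] by (metis inf.absorb2)
qed

text \<open>Truncation is continuous and \<open>sturmian2 \<alpha>\<close> is compact, so taking the
  closure commutes with truncating.\<close>

lemma sturmian1_eq: "sturmian1 \<alpha> = truncation ` sturmian2 \<alpha>"
proof -
  have "(rotation \<alpha> ^^ i) t = rotation_powi \<alpha> (int i) t" for i t
    by (simp add: rotation_powi_def)
  then have "{(\<lambda>i. sturmian_code \<alpha> ((rotation \<alpha> ^^ i) t)) | t. t \<in> {0..<1}} =
      truncation ` {(\<lambda>i. sturmian_code \<alpha> (rotation_powi \<alpha> i t)) | t. t \<in> {0..<1}}" (is "_ = truncation ` ?G2")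
    by (auto simp: truncation_def image_def)
  moreover have cont: "continuous_on A (truncation :: (int \<Rightarrow> nat) \<Rightarrow> _)" for A
    unfolding truncation_def
    by (intro continuous_on_coordinatewise_then_product
      continuous_on_subset[OF continuous_on_product_coordinates]) simp
  moreover have "closure (truncation ` ?G2) = truncation ` closure ?G2"
  proof
    have "closed (truncation ` closure ?G2)"
      by (intro compact_fun_imp_closed compact_continuous_image cont
        compact_sturmian2[unfolded sturmian2_def])
    then show "closure (truncation ` ?G2) \<subseteq> truncation ` closure ?G2"
      by (intro closure_minimal image_mono closure_subset)
    show "truncation ` closure ?G2 \<subseteq> closure (truncation ` ?G2)"
      by (rule image_closure_subset[OF cont]) (auto simp: closure_subset)
  qed
  ultimately show ?thesis
    by (simp add: sturmian1_def sturmian2_def)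
qed

lemma sturmian1_imp_code:
  assumes "x \<in> sturmian1 \<alpha>"
  obtains u t where "x = truncation (code u t)"
proof -
  obtain x' where "x' \<in> sturmian2 \<alpha>" "x = truncation x'"
    using assms by (auto simp: sturmian1_eq)
  then show thesis
    using that sturmian2_imp_code by metis
qed

section \<open>The branch point and its orbit\<close>

lemma shift_truncation_code: "shift (truncation (code u t)) = truncation (code u (t + \<alpha>))"
proof
  fix n
  show "shift (truncation (code u t)) n = truncation (code u (t + \<alpha>)) n"
    using mechanical_translate[of \<alpha> u t "int n" 1] by (simp add: shift_def truncation_def add.commute)
qed

text \<open>By irrationality no positive multiple of \<open>\<alpha>\<close> is an integer, so the
  two floors agree at every point involved.\<close>

lemma code_0_eq:
  assumes "i \<ge> 1"
  shows "code u 0 i = code v 0 i"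
proof -
  have nonint: "0 + of_int (i + 1) * \<alpha> \<notin> \<int>" "0 + of_int i * \<alpha> \<notin> \<int>"
    using assms int_mult_\<alpha>_in_Ints[of "i + 1"] int_mult_\<alpha>_in_Ints[of i] by simp_all
  show ?thesis
    by (simp only: mechanical_def sided_floor_nonint[OF nonint(1)] sided_floor_nonint[OF nonint(2)])
qed

lemma code_0_0: "code True 0 0 \<noteq> code False 0 0"
proof -
  have "\<alpha> \<notin> \<int>"
    using int_mult_\<alpha>_in_Ints[of 1] by simp
  then have "int (code True 0 0) \<noteq> int (code False 0 0)"
    unfolding int_code by (simp add: sided_floor_nonint) (simp add: sided_floor_def)
  then show ?thesis
    by simp
qed

text \<open>The two preimages are the codes with parameter 0, which differ at position 0 and agree
  to its right.\<close>

lemma branch_exists: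
  "\<exists>y\<in>sturmian1 \<alpha>. \<exists>z\<in>sturmian1 \<alpha>. y \<noteq> z \<and>
    shift y = truncation (code True \<alpha>) \<and> shift z = truncation (code True \<alpha>)"
proof (intro bexI conjI)
  show "truncation (code True 0) \<noteq> truncation (code False 0)"
    using code_0_0 by (metis of_nat_0 truncation_def)
  show "shift (truncation (code True 0)) = truncation (code True \<alpha>)"
    by (simp add: shift_truncation_code)
  show "shift (truncation (code False 0)) = truncation (code True \<alpha>)"
  proof
    fix n
    have "shift (truncation (code False 0)) n = code False 0 (int n + 1)"
      by (simp add: shift_def truncation_def add.commute)
    also have "\<dots> = code True 0 (int n + 1)"
      by (rule code_0_eq) simp
    also have "\<dots> = truncation (code True \<alpha>) n"
      using mechanical_translate[of \<alpha> True 0 "int n" 1] by (simp add: truncation_def)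
    finally show "shift (truncation (code False 0)) n = truncation (code True \<alpha>) n" .
  qed
qed (auto simp: sturmian1_eq code_in_sturmian2)

text \<open>The two words with parameter \<open>t\<close> differ at \<open>i\<close> exactly if one of \<open>t + i\<alpha>\<close>, \<open>t + (i + 1)\<alpha>\<close>
  is an integer.\<close>

lemma branch_parameter:
  assumes agree: "\<And>i. i \<ge> 1 \<Longrightarrow> code True t i = code False t i" and differ: "code True t 0 \<noteq> code False t 0"
  shows "t \<in> \<int>"
proof (rule ccontr)
  assume t: "t \<notin> \<int>"
  have "t + \<alpha> \<in> \<int>"
  proof (rule ccontr)
    assume "t + \<alpha> \<notin> \<int>"
    with t have "code True t 0 = code False t 0"
      by (simp add: mechanical_def sided_floor_nonint)
    with differ show False ..
  qed
  \<comment> \<open>Two points at distance \<open>\<alpha>\<close> cannot both be integers, so the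
    jump at \<open>t + \<alpha>\<close> is visible at position 1.\<close>
  moreover have "t + 2 * \<alpha> \<notin> \<int>"
  proof
    assume "t + 2 * \<alpha> \<in> \<int>"
    then have "(t + 2 * \<alpha>) - (t + \<alpha>) \<in> \<int>"
      using \<open>t + \<alpha> \<in> \<int>\<close> by (rule Ints_diff)
    then show False
      using int_mult_\<alpha>_in_Ints[of 1] by simp
  qed
  ultimately have "int (code True t 1) \<noteq> int (code False t 1)"
    unfolding int_code by (simp add: sided_floor_nonint sided_floor_int)
  with agree[of 1] show False
    by simp
qed

text \<open>Equal tails force equal parameters modulo 1, so the two points must come from different
  sides; \<open>branch_parameter\<close> then makes the parameter an integer.\<close>

lemma branch_unique:
  assumes "y \<in> sturmian1 \<alpha>" "z \<in> sturmian1 \<alpha>" "y \<noteq> z" "shift y = shift z"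
  shows "shift y = truncation (code True \<alpha>)"
proof -
  obtain u s v t where yz: "y = truncation (code u s)" "z = truncation (code v t)"
    using assms(1,2) sturmian1_imp_code by metis
  have agree: "code u s i = code v t i" if "i \<ge> 1" for i
    using fun_cong[OF assms(4), of "nat (i - 1)"] that
    by (simp add: yz shift_def truncation_def add.commute)
  then obtain m where "s = t + of_int m"
    using code_eq_imp[of 1 u s v t] by blast
  then have us: "code u s = code u t"
    by (simp add: mechanical_add_int)
  have uv: "u \<noteq> v"
    using assms(3) us by (auto simp: yz)
  have TF: "code True t i = code False t i" if "i \<ge> 1" for i
    using agree[OF that] us uv by (cases u; cases v) auto
  have "code True t 0 \<noteq> code False t 0"
  proof
    assume "code True t 0 = code False t 0"
    then have "code u t i = code v t i" if "i \<ge> 0" for i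
      using TF[of i] that by (cases "i = 0"; cases u; cases v) auto
    then have "y = z"
      by (auto simp: yz us truncation_def)
    with assms(3) show False ..
  qed
  with TF have "t \<in> \<int>"
    by (rule branch_parameter)
  then obtain k where k: "t = of_int k"
    by (elim Ints_cases)
  show ?thesis
  proof
    fix n
    have "shift y n = code u t (int n + 1)"
      by (simp add: yz us[symmetric] shift_def truncation_def add.commute)
    also have "\<dots> = code True t (int n + 1)"
      using TF[of "int n + 1"] by (cases u) auto
    also have "\<dots> = code True (\<alpha> + of_int k) (int n)"
      using mechanical_translate[of \<alpha> True t "int n" 1] by (simp add: k add.commute)
    also have "\<dots> = truncation (code True \<alpha>) n"
      by (simp add: mechanical_add_int truncation_def)
    finally show "shift y n = truncation (code True \<alpha>) n" .
  qed
qed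

lemma branch_point_eq: "branch_point \<alpha> = truncation (code True \<alpha>)"
  unfolding branch_point_def
proof (rule the_equality)
  show "truncation (code True \<alpha>) \<in> sturmian1 \<alpha> \<and> (\<exists>y\<in>sturmian1 \<alpha>. \<exists>z\<in>sturmian1 \<alpha>. y \<noteq> z \<and>
      shift y = truncation (code True \<alpha>) \<and> shift z = truncation (code True \<alpha>))"
    using branch_exists by (simp add: sturmian1_eq code_in_sturmian2)
qed (use branch_unique in metis)

text \<open>Sharing a tail with the branch point fixes the parameter up to integers and integer
  multiples of \<open>\<alpha>\<close>. The excluded set is countable, so \<open>code_approx\<close>
  can avoid it.\<close>

lemma truncation_code_not_orbit:
  assumes "s \<notin> range (\<lambda>(a, b). of_int a + of_int b * \<alpha>)"
  shows "truncation (code True s) \<notin> shift_orbit X (branch_point \<alpha>)"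
proof
  assume "truncation (code True s) \<in> shift_orbit X (branch_point \<alpha>)"
  then obtain k l where kl: "suffix l (truncation (code True s)) = suffix k (truncation (code True \<alpha>))"
    by (auto simp: shift_orbit_def shift_funpow branch_point_eq)
  have "code True (s + of_int l * \<alpha>) i = code True (\<alpha> + of_int k * \<alpha>) i" if "i \<ge> 0" for i
    using fun_cong[OF kl, of "nat i"] that mechanical_translate[of \<alpha> True s i l]
      mechanical_translate[of \<alpha> True \<alpha> i k] by (simp add: truncation_def add.commute)
  then obtain m where "s + of_int l * \<alpha> = \<alpha> + of_int k * \<alpha> + of_int m"
    using code_eq_imp by metis
  then have "s = of_int m + of_int (1 + int k - int l) * \<alpha>"
    by (simp add: algebra_simps)
  with assms show False
    by (metis (mono_tags, lifting) case_prod_conv rangeI)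
qed

lemma translate_sturmian2:
  assumes "x \<in> sturmian2 \<alpha>"
  shows "(\<lambda>i. x (i + m)) \<in> sturmian2 \<alpha>"
proof -
  obtain u t where "x = code u t"
    using assms by (rule sturmian2_imp_code)
  then have "(\<lambda>i. x (i + m)) = code u (t + of_int m * \<alpha>)"
    by (simp add: mechanical_translate)
  then show ?thesis
    by (simp add: code_in_sturmian2)
qed

lemma dense_off_orbit:
  assumes "x \<in> sturmian2 \<alpha>"
  shows "\<exists>y\<in>sturmian2 \<alpha>. y \<noteq> x \<and> (\<forall>i. \<bar>i\<bar> \<le> int n \<longrightarrow> y i = x i) \<and>
    truncation y \<notin> shift_orbit X (branch_point \<alpha>)"
proof -
  obtain u t where x: "x = code u t"
    using assms by (rule sturmian2_imp_code)
  have "countable (range (\<lambda>(a, b). of_int a + of_int b * \<alpha>))"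
    by simp
  then obtain s where "s \<notin> range (\<lambda>(a, b). of_int a + of_int b * \<alpha>)" "code True s \<noteq> code u t"
    "\<And>i. \<bar>i\<bar> \<le> int n \<Longrightarrow> code True s i = code u t i"
    using code_approx by metis
  then show ?thesis
    using truncation_code_not_orbit code_in_sturmian2 unfolding x by blast
qed

lemma branched_shift_sturmian: "branched_shift (sturmian2 \<alpha>) (sturmian1 \<alpha>) (branch_point \<alpha>)"
proof
  show "\<exists>y\<in>sturmian1 \<alpha>. \<exists>z\<in>sturmian1 \<alpha>. y \<noteq> z \<and>
      shift y = branch_point \<alpha> \<and> shift z = branch_point \<alpha>"
    unfolding branch_point_eq by (rule branch_exists)
  show "shift y = branch_point \<alpha>"
    if "y \<in> sturmian1 \<alpha>" "z \<in> sturmian1 \<alpha>" "y \<noteq> z" "shift y = shift z" for y z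
    unfolding branch_point_eq using that by (rule branch_unique)
qed (fact compact_sturmian2 translate_sturmian2 sturmian1_eq dense_off_orbit)+

end

theorem corollary4p12:
  fixes \<alpha> :: real
  assumes "\<alpha> \<in> {0<..<1} - \<rat>"
  shows "cover_nonisolated \<alpha> =
      cover_topology (sturmian1 \<alpha>) derived_set_of cover (sturmian1 \<alpha>) \<and>
    conjugate
      (subtopology (cover_topology (sturmian1 \<alpha>)) (cover_nonisolated \<alpha>))
      (cover_shift (sturmian1 \<alpha>))
      (top_of_set (sturmian2 \<alpha>)) shift \<and>
    (\<exists>i. continuous_map (top_of_set (sturmian2 \<alpha>)) (cover_topology (sturmian1 \<alpha>)) i \<and>
      inj_on i (sturmian2 \<alpha>) \<and>
      (\<forall>x \<in> sturmian2 \<alpha>. i (shift x) = cover_shift (sturmian1 \<alpha>) (i x)) \<and>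
      (\<forall>x \<in> sturmian2 \<alpha>. truncation x = cover_proj (sturmian1 \<alpha>) (i x)))"
proof -
  interpret irrational_slope \<alpha>
    using assms by unfold_locales
  interpret branched_shift "sturmian2 \<alpha>" "sturmian1 \<alpha>" "branch_point \<alpha>"
    by (rule branched_shift_sturmian)
  \<comment> \<open>With the nonisolated part written as the image of \<open>embed\<close>, that map
    serves both for the conjugacy and as the sliding block code.\<close>
  have nonisolated: "cover_nonisolated \<alpha> = embed ` sturmian2 \<alpha>"
    by (simp add: cover_nonisolated_def cover_minus_orbit)
  show ?thesis
    unfolding nonisolated
  proof (intro conjI exI[of _ embed] ballI)
    show "embed ` sturmian2 \<alpha> = cover_topology (sturmian1 \<alpha>) derived_set_of cover (sturmian1 \<alpha>)"
      by (rule derived_set_cover[symmetric])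
  qed (simp_all only: conjugate_embed continuous_embed inj_on_embed embed_shift cover_proj_embed)
qed

end
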